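(* Let $r\in\{0,1\}$ and let $\boldsymbol g:\mathbb C^n\times\mathbb C^n\times\{(\tau,w)\in\mathbb H\times\mathbb H:\tau\neq w\}\to\mathbb C^m$ be a vector-valued function such that $(i(w-\tau))^{\frac r2}\boldsymbol g(\boldsymbol z,\boldsymbol{\mathfrak z};\tau,w)$ is holomorphic on $\mathbb C^n\times\mathbb C^n\times\{(\tau,w)\in\mathbb H\times\mathbb H:\tau\ne w\}$. For $\gamma=\begin{pmatrix}a&b\\c&d\end{pmatrix}\in\mathrm{SL}_2(\mathbb Z)$ and $\boldsymbol m,\boldsymbol r\in\Lambda$ consider the action of the Jacobi group $\mathrm{SL}_2(\mathbb Z)\ltimes\Lambda^2$ on such functions $$\boldsymbol g|_{k,Q}(\gamma,\boldsymbol m,\boldsymbol r)(\boldsymbol z,\boldsymbol{\mathfrak z};\tau,w):=\chi_{\tau,w}(\gamma)^r(c\tau+d)^{-k}e^{2\pi i\left(-\frac{cQ(\boldsymbol z+\boldsymbol m\tau+\boldsymbol r)}{c\tau+d}+Q(\boldsymbol m)\tau+B(\boldsymbol m,\boldsymbol z)+Q(\boldsymbol m+\boldsymbol r)\right)}\rho(\gamma)^{-1}\boldsymbol g\left(\frac{\boldsymbol z+\boldsymbol m\tau+\boldsymbol r}{c\tau+d},\frac{\boldsymbol{\mathfrak z}+\boldsymbol mw+\boldsymbol r}{cw+d};\frac{a\tau+b}{c\tau+d},\frac{aw+b}{cw+d}\right),$$ where $$\chi_{\tau,w}(\gamma):=\sqrt{\frac{i(w-\tau)}{(c\tau+d)(cw+d)}}\;\frac{\sqrt{c\tau+d}\sqrt{cw+d}}{\sqrt{i(w-\tau)}}\in\{\pm1\}$$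 and $\rho(\gamma)$ is an $m\times m$ unitary matrix forming a projective representation of the modular group in a way that makes the action well-defined. Then the differential operators $\mathcal D_\alpha,\mathsf d_\alpha,R_k,L$ (defined in the context) satisfy, for $\alpha\in\{1,\dots,n\}$, $$\mathcal D_\alpha(\boldsymbol g|_{k,Q}(\gamma,\boldsymbol m,\boldsymbol r))=\mathcal D_\alpha(\boldsymbol g)|_{k+1,Q}(\gamma,\boldsymbol m,\boldsymbol r),\qquad \mathsf d_\alpha(\boldsymbol g|_{k,Q}(\gamma,\boldsymbol m,\boldsymbol r))=\mathsf d_\alpha(\boldsymbol g)|_{k-1,Q}(\gamma,\boldsymbol m,\boldsymbol r),$$ $$R_k(\boldsymbol g|_{k,Q}(\gamma,\boldsymbol m,\boldsymbol r))=R_k(\boldsymbol g)|_{k+2,Q}(\gamma,\boldsymbol m,\boldsymbol r),\qquad L(\boldsymbol g|_{k,Q}(\gamma,\boldsymbol m,\boldsymbol r))=L(\boldsymbol g)|_{k-2,Q}(\gamma,\boldsymbol m,\boldsymbol r).$$ Furthermore, for $\alpha,\beta\in\{1,\dots,n\}$ these operators satisfy $$[\mathcal D_\alpha,\mathcal D_\beta]=[\mathsf d_\alpha,\mathsf d_\beta]=0,\qquad[\mathcal D_\alpha,\mathsf d_\beta]=2\pi iA_{\alpha\beta},\qquad L\circ R_k-R_{k-2}\circ L=k,$$ $$\mathsf d_\alpha\circ R_k-R_{k-1}\circ\mathsf d_\alpha=-\mathcal D_\alpha,\qquad[\mathsf d_\alpha,L]=0,$$ $$\mathcal D_\alpha\circ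 R_k-R_{k+1}\circ\mathcal D_\alpha=0,\qquad[\mathcal D_\alpha,L]=\mathsf d_\alpha .$$
   Context: $\Lambda$ is a rank $n$ lattice, identified with $\mathbb Z^n$, with bilinear form $B(\boldsymbol x,\boldsymbol y)=\boldsymbol x^TA\boldsymbol y$, $A=(A_{\alpha\beta})\in\mathbb Z^{n\times n}$ symmetric positive definite, extended bilinearly to $\mathbb C^n$, and $Q(\boldsymbol x)=\frac12B(\boldsymbol x,\boldsymbol x)$. $\mathbb H$ is the upper half-plane; square roots and half-integral powers are principal values; $k$ is the weight ($k\in\frac12\mathbb Z$). $\boldsymbol{\partial_z}=(\partial_{z_1},\dots,\partial_{z_n})^T$, similarly $\boldsymbol{\partial_{\mathfrak z}}$. The differential operators (acting on functions of $(\boldsymbol z,\boldsymbol{\mathfrak z};\tau,w)$, componentwise for vector-valued functions) are $$R_k:=\partial_\tau+\frac{(\boldsymbol z-\boldsymbol{\mathfrak z})^T}{\tau-w}\boldsymbol{\partial_z}+2\pi iQ\left(\frac{\boldsymbol z-\boldsymbol{\mathfrak z}}{\tau-w}\right)+\frac{k}{\tau-w},\qquad L:=(\tau-w)\left((\tau-w)\partial_w+(\boldsymbol z-\boldsymbol{\mathfrak z})^T\boldsymbol{\partial_{\mathfrak z}}\right),$$ $$\boldsymbol{\mathcal D}:=\boldsymbol{\partial_z}+\frac{2\pi i}{\tau-w}A(\boldsymbol z-\boldsymbol{\mathfrak z}),\qquad\boldsymbol{\mathsf d}:=(\tau-w)\boldsymbol{\partial_{\mathfrak z}},$$ with components $\mathcal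 D_\alpha$, $\mathsf d_\alpha$. *)

theory Defs
  imports "HOL-Analysis.Analysis"
begin

unbundle no fps_syntax

definition cvec :: "int ^ ('n::finite) \<Rightarrow> complex ^ 'n" where
  "cvec \<mu> = (\<chi> \<alpha>. of_int (\<mu> $ \<alpha>))"

definition bform :: "int ^ ('n::finite) ^ 'n \<Rightarrow> complex ^ 'n \<Rightarrow> complex ^ 'n \<Rightarrow> complex" where
  "bform A x y = (\<Sum>\<alpha>\<in>UNIV. \<Sum>\<beta>\<in>UNIV. x $ \<alpha> * of_int (A $ \<alpha> $ \<beta>) * y $ \<beta>)"

definition qform :: "int ^ ('n::finite) ^ 'n \<Rightarrow> complex ^ 'n \<Rightarrow> complex" where
  "qform A x = bform A x x / 2"

definition symmetric_pos_def :: "int ^ ('n::finite) ^ 'n \<Rightarrow> bool" where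
  "symmetric_pos_def A \<longleftrightarrow> transpose A = A \<and>
     (\<forall>x :: real ^ 'n. x \<noteq> 0 \<longrightarrow> x \<bullet> (map_matrix of_int A *v x) > 0)"

type_synonym ('n, 'm) jfun =
  "complex ^ 'n \<Rightarrow> complex ^ 'n \<Rightarrow> complex \<Rightarrow> complex \<Rightarrow> complex ^ 'm"

definition half_pairs :: "(complex \<times> complex) set" where
  "half_pairs = {(\<tau>, w). Im \<tau> > 0 \<and> Im w > 0 \<and> \<tau> \<noteq> w}"

text \<open>Holomorphy in several variables on the open set \<open>UNIV \<times> UNIV \<times> half_pairs\<close>:
  the Frechet derivative exists at every point and is complex linear.\<close>

definition holomorphic_jfun :: "('n::finite, 'm::finite) jfun \<Rightarrow> bool" where
  "holomorphic_jfun f \<longleftrightarrow> (\<forall>z \<zeta> \<tau> w. (\<tau>, w) \<in> half_pairs \<longrightarrow>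
     (\<exists>F. ((\<lambda>(z, \<zeta>, \<tau>, w). f z \<zeta> \<tau> w) has_derivative F) (at (z, \<zeta>, \<tau>, w)) \<and>
          (\<forall>c x y s t. F (c *s x, c *s y, c * s, c * t) = c *s F (x, y, s, t))))"

definition admissible :: "nat \<Rightarrow> ('n::finite, 'm::finite) jfun \<Rightarrow> bool" where
  "admissible r g \<longleftrightarrow>
     holomorphic_jfun (\<lambda>z \<zeta> \<tau> w. ((\<i> * (w - \<tau>)) powr (of_nat r / 2)) *s g z \<zeta> \<tau> w)"

text \<open>For \<open>r = 1\<close> an admissible function is a holomorphic function divided by the principal value
  of \<open>sqrt (\<i> * (w - \<tau>))\<close>. It is therefore not continuous on the branch cut
  \<open>Re \<tau> = Re w \<and> Im \<tau> < Im w\<close>, and there \<open>\<partial>/\<partial>\<tau>\<close> and \<open>\<partial>/\<partial>w\<close> have to be read as derivatives of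
  the local holomorphic branch with the given value. (The Jacobi group action does not preserve
  the cut, so the cut cannot be left out.)  Since the cut is made of vertical lines in
  \<open>\<tau>\<close> and in \<open>w\<close>, differentiating within the vertical line through the point gives exactly this
  branch derivative; wherever a complex derivative exists, it gives that derivative.  The lemmas
  below make this precise.\<close>

definition branch_deriv :: "(complex \<Rightarrow> complex) \<Rightarrow> complex \<Rightarrow> complex" where
  "branch_deriv f x = (THE D. (f has_field_derivative D) (at x within {y. Re y = Re x}))"

lemma branch_deriv_eqI:
  assumes "(f has_field_derivative D) (at x within {y. Re y = Re x})"
  shows "branch_deriv f x = D"
proof -
  have nt: "at x within {y. Re y = Re x} \<noteq> bot"
  proof -
    have "x islimpt {y. Re y = Re x}"
      unfolding islimpt_approachable
    proof (intro allI impI)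
      fix e :: real assume "e > 0"
      then show "\<exists>x'\<in>{y. Re y = Re x}. x' \<noteq> x \<and> dist x' x < e"
        by (intro bexI[of _ "x + \<i> * of_real (e / 2)"]) (auto simp: dist_norm norm_mult)
    qed
    then show ?thesis by (simp add: trivial_limit_within)
  qed
  show ?thesis
    unfolding branch_deriv_def
  proof (rule the_equality)
    show "(f has_field_derivative D) (at x within {y. Re y = Re x})" by (fact assms)
    fix E assume "(f has_field_derivative E) (at x within {y. Re y = Re x})"
    then show "E = D"
      using assms nt unfolding has_field_derivative_iff by (blast intro: tendsto_unique)
  qed
qed

lemma branch_deriv_eq_deriv:
  assumes "f field_differentiable (at x)"
  shows "branch_deriv f x = deriv f x"
  using assms
  by (intro branch_deriv_eqI) (auto simp: field_differentiable_derivI intro: has_field_derivative_at_within)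

lemma branch_deriv_local_branch:
  assumes "h field_differentiable (at x)"
    and "open U" "x \<in> U" "\<And>y. y \<in> U \<Longrightarrow> Re y = Re x \<Longrightarrow> f y = h y"
  shows "branch_deriv f x = deriv h x"
proof (rule branch_deriv_eqI)
  have "(h has_field_derivative deriv h x) (at x within {y. Re y = Re x})"
    using assms(1) by (simp add: field_differentiable_derivI has_field_derivative_at_within)
  then have "(h has_field_derivative deriv h x) (at x within ({y. Re y = Re x} \<inter> U))"
    by (rule DERIV_subset) auto
  then have "(f has_field_derivative deriv h x) (at x within ({y. Re y = Re x} \<inter> U))"
    by (rule has_field_derivative_transform_within[OF _ zero_less_one]) (use assms in auto)
  then show "(f has_field_derivative deriv h x) (at x within {y. Re y = Re x})"
    using at_within_nhd[OF assms(3,2), of "{y. Re y = Re x} \<inter> U" "{y. Re y = Re x}"] by auto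
qed

lemma branch_deriv_inverse_csqrt:
  assumes "\<tau> \<noteq> w"
  shows "branch_deriv (\<lambda>t. 1 / csqrt (\<i> * (w - t))) \<tau> = 1 / (2 * (w - \<tau>)) * (1 / csqrt (\<i> * (w - \<tau>)))"
proof (cases "\<i> * (w - \<tau>) \<in> \<real>\<^sub>\<le>\<^sub>0")
  case False
  have q: "csqrt (\<i> * (w - \<tau>)) * csqrt (\<i> * (w - \<tau>)) = \<i> * (w - \<tau>)"
    by (metis power2_csqrt power2_eq_square)
  have "((\<lambda>t. 1 / csqrt (\<i> * (w - t))) has_field_derivative
          1 / (2 * (w - \<tau>)) * (1 / csqrt (\<i> * (w - \<tau>)))) (at \<tau>)"
    by (rule derivative_eq_intros refl False)+ (use assms in \<open>simp_all add: q\<close>)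
  then show ?thesis
    by (rule branch_deriv_eqI[OF has_field_derivative_at_within])
next
  case True
  then have "Re \<tau> = Re w" "Im \<tau> \<le> Im w"
    by (simp_all add: complex_nonpos_Reals_iff)
  with assms have cut: "Re \<tau> = Re w" "Im \<tau> < Im w"
    by (metis complex_eqI order_le_less)+
  define h where "h = (\<lambda>t. 1 / (\<i> * csqrt (- (\<i> * (w - t)))))"
  have nr: "- (\<i> * (w - \<tau>)) \<notin> \<real>\<^sub>\<le>\<^sub>0"
    using cut by (simp add: complex_nonpos_Reals_iff)
  have q: "csqrt (- (\<i> * (w - \<tau>))) * csqrt (- (\<i> * (w - \<tau>))) = - (\<i> * (w - \<tau>))"
    by (metis power2_csqrt power2_eq_square)
  have q': "csqrt (- (\<i> * (w - \<tau>))) * (\<i> * csqrt (- (\<i> * (w - \<tau>)))) = w - \<tau>"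
    using arg_cong[OF q, of "\<lambda>x. \<i> * x"] by (simp only: mult_ac) (simp add: algebra_simps)
  have h: "(h has_field_derivative 1 / (2 * (w - \<tau>)) * h \<tau>) (at \<tau>)"
    unfolding h_def
    by (rule derivative_eq_intros refl nr)+ (use assms q' in \<open>simp_all add: q\<close>)
  have eq: "1 / csqrt (\<i> * (w - t)) = h t" if "Im t < Im w" "Re t = Re \<tau>" for t
    using that cut unfolding h_def by (simp del: csqrt.simps)
  have hd: "h field_differentiable (at \<tau>)" 
    using h unfolding field_differentiable_def by blast
  have "branch_deriv (\<lambda>t. 1 / csqrt (\<i> * (w - t))) \<tau> = deriv h \<tau>"
    by (rule branch_deriv_local_branch[OF hd open_halfspace_Im_lt[of "Im w"]])
      (use cut(2) in simp, rule eq, simp)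
  then show ?thesis
    using DERIV_imp_deriv[OF h] eq[OF cut(2) refl] by (simp only:)
qed

definition d_z :: "'n::finite \<Rightarrow> ('n, 'm::finite) jfun \<Rightarrow> ('n, 'm) jfun" where
  "d_z \<alpha> g z \<zeta> \<tau> w = (\<chi> j. deriv (\<lambda>t. g (z + axis \<alpha> t) \<zeta> \<tau> w $ j) 0)"

definition d_zeta :: "'n::finite \<Rightarrow> ('n, 'm::finite) jfun \<Rightarrow> ('n, 'm) jfun" where
  "d_zeta \<alpha> g z \<zeta> \<tau> w = (\<chi> j. deriv (\<lambda>t. g z (\<zeta> + axis \<alpha> t) \<tau> w $ j) 0)"

definition d_tau :: "('n::finite, 'm::finite) jfun \<Rightarrow> ('n, 'm) jfun" where
  "d_tau g z \<zeta> \<tau> w = (\<chi> j. branch_deriv (\<lambda>t. g z \<zeta> t w $ j) \<tau>)"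

definition d_w :: "('n::finite, 'm::finite) jfun \<Rightarrow> ('n, 'm) jfun" where
  "d_w g z \<zeta> \<tau> w = (\<chi> j. branch_deriv (\<lambda>t. g z \<zeta> \<tau> t $ j) w)"

definition opR :: "int ^ ('n::finite) ^ 'n \<Rightarrow> real \<Rightarrow> ('n, 'm::finite) jfun \<Rightarrow> ('n, 'm) jfun" where
  "opR A k g z \<zeta> \<tau> w =
     d_tau g z \<zeta> \<tau> w
     + (\<Sum>\<alpha>\<in>UNIV. ((z $ \<alpha> - \<zeta> $ \<alpha>) / (\<tau> - w)) *s d_z \<alpha> g z \<zeta> \<tau> w)
     + (2 * of_real pi * \<i> * qform A ((1 / (\<tau> - w)) *s (z - \<zeta>))) *s g z \<zeta> \<tau> w
     + (of_real k / (\<tau> - w)) *s g z \<zeta> \<tau> w"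

definition opL :: "('n::finite, 'm::finite) jfun \<Rightarrow> ('n, 'm) jfun" where
  "opL g z \<zeta> \<tau> w =
     (\<tau> - w) *s ((\<tau> - w) *s d_w g z \<zeta> \<tau> w
       + (\<Sum>\<alpha>\<in>UNIV. (z $ \<alpha> - \<zeta> $ \<alpha>) *s d_zeta \<alpha> g z \<zeta> \<tau> w))"

definition opD :: "int ^ ('n::finite) ^ 'n \<Rightarrow> 'n \<Rightarrow> ('n, 'm::finite) jfun \<Rightarrow> ('n, 'm) jfun" where
  "opD A \<alpha> g z \<zeta> \<tau> w =
     d_z \<alpha> g z \<zeta> \<tau> w
     + (2 * of_real pi * \<i> / (\<tau> - w) * (map_matrix of_int A *v (z - \<zeta>)) $ \<alpha>) *s g z \<zeta> \<tau> w"

definition opd :: "'n::finite \<Rightarrow> ('n, 'm::finite) jfun \<Rightarrow> ('n, 'm) jfun" where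
  "opd \<alpha> g z \<zeta> \<tau> w = (\<tau> - w) *s d_zeta \<alpha> g z \<zeta> \<tau> w"

definition SL2Z :: "(int ^ 2 ^ 2) set" where
  "SL2Z = {\<gamma>. det \<gamma> = 1}"

type_synonym 'n jacobi = "(int ^ 2 ^ 2) \<times> (int ^ 'n) \<times> (int ^ 'n)"

definition jacobi_group :: "'n jacobi set" where
  "jacobi_group = {(\<gamma>, \<mu>, \<nu>). \<gamma> \<in> SL2Z}"

text \<open>The semidirect product in which \<open>SL2Z\<close> acts from the right on row vectors \<open>(\<mu>, \<nu>)\<close>:
  \<open>(\<gamma>, X) (\<gamma>', X') = (\<gamma> \<gamma>', X \<gamma>' + X')\<close>.\<close>

definition jacobi_mult :: "('n::finite) jacobi \<Rightarrow> 'n jacobi \<Rightarrow> 'n jacobi" where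
  "jacobi_mult = (\<lambda>(\<gamma>, \<mu>, \<nu>) (\<gamma>', \<mu>', \<nu>').
     (\<gamma> ** \<gamma>',
      \<gamma>' $ 1 $ 1 *s \<mu> + \<gamma>' $ 2 $ 1 *s \<nu> + \<mu>',
      \<gamma>' $ 1 $ 2 *s \<mu> + \<gamma>' $ 2 $ 2 *s \<nu> + \<nu>'))"

definition jacobi_one :: "('n::finite) jacobi" where
  "jacobi_one = (mat 1, 0, 0)"

definition autf :: "int ^ 2 ^ 2 \<Rightarrow> complex \<Rightarrow> complex" where
  "autf \<gamma> \<tau> = of_int (\<gamma> $ 2 $ 1) * \<tau> + of_int (\<gamma> $ 2 $ 2)"

definition moeb :: "int ^ 2 ^ 2 \<Rightarrow> complex \<Rightarrow> complex" where
  "moeb \<gamma> \<tau> = (of_int (\<gamma> $ 1 $ 1) * \<tau> + of_int (\<gamma> $ 1 $ 2)) / autf \<gamma> \<tau>"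

definition chi :: "complex \<Rightarrow> complex \<Rightarrow> int ^ 2 ^ 2 \<Rightarrow> complex" where
  "chi \<tau> w \<gamma> =
     csqrt (\<i> * (w - \<tau>) / (autf \<gamma> \<tau> * autf \<gamma> w))
     * (csqrt (autf \<gamma> \<tau>) * csqrt (autf \<gamma> w) / csqrt (\<i> * (w - \<tau>)))"

definition slash ::
  "int ^ ('n::finite) ^ 'n \<Rightarrow> nat \<Rightarrow> (int ^ 2 ^ 2 \<Rightarrow> complex ^ ('m::finite) ^ 'm) \<Rightarrow> real
    \<Rightarrow> ('n, 'm) jfun \<Rightarrow> 'n jacobi \<Rightarrow> ('n, 'm) jfun" where
  "slash A r \<rho> k g = (\<lambda>(\<gamma>, \<mu>, \<nu>) z \<zeta> \<tau> w.
     (chi \<tau> w \<gamma> ^ r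
      * autf \<gamma> \<tau> powr (- of_real k)
      * exp (2 * of_real pi * \<i> *
          (- (of_int (\<gamma> $ 2 $ 1) * qform A (z + \<tau> *s cvec \<mu> + cvec \<nu>)) / autf \<gamma> \<tau>
           + qform A (cvec \<mu>) * \<tau> + bform A (cvec \<mu>) z + qform A (cvec \<mu> + cvec \<nu>))))
     *s (matrix_inv (\<rho> \<gamma>) *v
          g ((1 / autf \<gamma> \<tau>) *s (z + \<tau> *s cvec \<mu> + cvec \<nu>))
            ((1 / autf \<gamma> w) *s (\<zeta> + w *s cvec \<mu> + cvec \<nu>))
            (moeb \<gamma> \<tau>) (moeb \<gamma> w)))"

definition unitary_matrix :: "complex ^ ('m::finite) ^ 'm \<Rightarrow> bool" where
  "unitary_matrix U \<longleftrightarrow>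
     U ** map_matrix cnj (transpose U) = mat 1 \<and> map_matrix cnj (transpose U) ** U = mat 1"

definition projective_rep :: "(int ^ 2 ^ 2 \<Rightarrow> complex ^ ('m::finite) ^ 'm) \<Rightarrow> bool" where
  "projective_rep \<rho> \<longleftrightarrow>
     (\<forall>\<gamma>\<in>SL2Z. invertible (\<rho> \<gamma>)) \<and>
     (\<forall>\<gamma>\<in>SL2Z. \<forall>\<gamma>'\<in>SL2Z. \<exists>c. c \<noteq> 0 \<and> \<rho> (\<gamma> ** \<gamma>') = map_matrix ((*) c) (\<rho> \<gamma> ** \<rho> \<gamma>'))"

text \<open>The slash operation is a right action of the Jacobi group on admissible functions
  (which only matter on \<open>half_pairs\<close>).\<close>

definition slash_well_defined ::
  "int ^ ('n::finite) ^ 'n \<Rightarrow> nat \<Rightarrow> (int ^ 2 ^ 2 \<Rightarrow> complex ^ ('m::finite) ^ 'm) \<Rightarrow> real \<Rightarrow> bool" where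
  "slash_well_defined A r \<rho> k \<longleftrightarrow>
     (\<forall>g. admissible r g \<longrightarrow> (\<forall>z \<zeta> \<tau> w. (\<tau>, w) \<in> half_pairs \<longrightarrow>
        slash A r \<rho> k g jacobi_one z \<zeta> \<tau> w = g z \<zeta> \<tau> w \<and>
        (\<forall>\<xi>\<in>jacobi_group. \<forall>\<xi>'\<in>jacobi_group.
           slash A r \<rho> k (slash A r \<rho> k g \<xi>) \<xi>' z \<zeta> \<tau> w
             = slash A r \<rho> k g (jacobi_mult \<xi> \<xi>') z \<zeta> \<tau> w)))"

end

theory Submission
  imports Defs "HOL-Complex_Analysis.Cauchy_Integral_Formula"
begin

unbundle no fps_syntax

text \<open>
  Write a point as \<open>p = (z, \<zeta>, \<tau>, w)\<close>. Each of the four operators has the form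
  \<open>f \<mapsto> (\<lambda>p. Df f p (v p) + b p * f p)\<close>, that is, the derivative along a holomorphic vector
  field \<open>v\<close> plus multiplication by a potential \<open>b\<close>. Two general facts about such first-order
  operators carry the proof.

  First, since mixed second derivatives of a holomorphic function agree, the commutator of
  \<open>(v, b)\<close> and \<open>(w, c)\<close> is again of first order: its field is the Lie bracket \<open>w' v - v' w\<close> and its
  potential is \<open>c' v - b' w\<close> (\<open>first_order_commutator\<close>). Every commutation relation of the theorem
  thus becomes an identity between rational expressions in the coordinates. Replacing \<open>k\<close> by
  \<open>k - 2\<close>, \<open>k - 1\<close> or \<open>k + 1\<close> in the raising operator only adds a multiple of \<open>1 / (\<tau> - w)\<close> to its potential.

  Second, for a map \<open>\<Phi>\<close> and a nowhere vanishing factor \<open>J\<close>, the operator \<open>(v, b)\<close> intertwines with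
  \<open>f \<mapsto> J * (f \<circ> \<Phi>)\<close> up to a factor \<open>\<mu>\<close> as soon as \<open>\<Phi>\<close> pushes \<open>v\<close> to \<open>\<mu>\<close> times \<open>v\<close> and
  \<open>dlog J (v) + b = \<mu> * (b \<circ> \<Phi>)\<close> (\<open>first_order_pullback\<close>). For the action of the Jacobi group these
  conditions hold with \<open>\<mu>\<close> a power of \<open>c\<tau> + d\<close>, which is exactly the change of weight. They come down to
  the fact that the slope \<open>(z - \<zeta>) / (\<tau> - w)\<close> transforms affinely (\<open>jact_slope\<close>).

  The factor \<open>(\<i>(w - \<tau>)) powr (- r / 2)\<close>, on whose branch cut \<open>g\<close> may be discontinuous, is split off
  beforehand: \<open>g\<close> is this factor times a holomorphic \<open>f\<close>. Along vertical lines the factor has logarithmic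
  derivatives \<open>- r / 2 / (\<tau> - w)\<close> in \<open>\<tau>\<close> and \<open>r / 2 / (\<tau> - w)\<close> in \<open>w\<close>, on the cut as well as off it, so the
  operators act on \<open>f\<close> through shifted potentials only: \<open>R\<close> of weight \<open>k\<close> becomes \<open>R\<close> of weight
  \<open>k - r / 2\<close>, and \<open>L\<close> acquires the potential \<open>r / 2 * (\<tau> - w)\<close> (\<open>is_lift_R\<close>, \<open>is_lift_L\<close>). The sign \<open>\<chi>\<close>
  is precisely what makes the slash operation respect this splitting (\<open>chi_inv_root\<close>), and all remaining
  work concerns functions holomorphic on the whole domain.
\<close>

section \<open>Holomorphic functions on complex vector spaces\<close>

abbreviation Df :: "('a::real_normed_vector \<Rightarrow> complex) \<Rightarrow> 'a \<Rightarrow> 'a \<Rightarrow> complex" where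
  "Df f p \<equiv> frechet_derivative f (at p)"

text \<open>A complex structure on a Euclidean space: holomorphy means that the real Frechet derivative
  commutes with the complex scaling \<open>sc\<close>.\<close>

locale complex_space = vector_space sc
  for sc :: "complex \<Rightarrow> 'a::euclidean_space \<Rightarrow> 'a" +
  assumes sc_of_real: "sc (of_real r) x = r *\<^sub>R x"
begin

definition holo :: "'a set \<Rightarrow> ('a \<Rightarrow> complex) \<Rightarrow> bool" where
  "holo S f \<longleftrightarrow> (\<forall>p\<in>S. \<exists>F. (f has_derivative F) (at p) \<and> (\<forall>c v. F (sc c v) = c * F v))"

lemma sc_eq: "sc c v = Re c *\<^sub>R v + Im c *\<^sub>R sc \<i> v"
proof -
  have "sc c v = sc (of_real (Re c) + of_real (Im c) * \<i>) v"
    by (rule arg_cong[of _ _ "\<lambda>c. sc c v"]) (simp add: complex_eq_iff)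
  also have "\<dots> = Re c *\<^sub>R v + Im c *\<^sub>R sc \<i> v"
    by (simp only: scale_left_distrib sc_of_real flip: scale_scale)
  finally show ?thesis .
qed

lemma sc_line: "(\<lambda>t. sc t e) = (\<lambda>t. Re t *\<^sub>R e + Im t *\<^sub>R sc \<i> e)"
  by (rule ext) (rule sc_eq)

lemma has_derivative_sc: "((\<lambda>t. sc t e) has_derivative (\<lambda>t. sc t e)) (at t)"
  by (subst (1 2) sc_line) (auto intro!: derivative_eq_intros)

lemma continuous_on_sc [continuous_intros]:
  assumes "continuous_on S f" shows "continuous_on S (\<lambda>x. sc (f x) e)"
  by (subst sc_eq) (intro continuous_intros assms)

lemma holoI:
  assumes "\<And>p. p \<in> S \<Longrightarrow> (f has_derivative F p) (at p)" "\<And>p c v. p \<in> S \<Longrightarrow> F p (sc c v) = c * F p v"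
  shows "holo S f"
  using assms unfolding holo_def by blast

lemma holo_has_derivative:
  assumes "holo S f" "p \<in> S" shows "(f has_derivative Df f p) (at p)"
  using assms unfolding holo_def by (metis frechet_derivative_at)

lemma holo_sc: "holo S f \<Longrightarrow> p \<in> S \<Longrightarrow> Df f p (sc c v) = c * Df f p v"
  unfolding holo_def by (metis frechet_derivative_at)

lemma holo_linear: "holo S f \<Longrightarrow> p \<in> S \<Longrightarrow> linear (Df f p)"
  using has_derivative_linear holo_has_derivative by blast

lemma holo_continuous: "holo S f \<Longrightarrow> continuous_on S f"
  by (meson continuous_at_imp_continuous_on has_derivative_continuous holo_has_derivative)

text \<open>Restricting to a complex line reduces several variables to one.\<close>

lemma holo_line:
  assumes "holo S f" "p + sc t e \<in> S"
  shows "((\<lambda>t. f (p + sc t e)) has_field_derivative Df f (p + sc t e) e) (at t)"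
proof -
  have "((\<lambda>t. p + sc t e) has_derivative (\<lambda>t. sc t e)) (at t)"
    using has_derivative_add[OF has_derivative_const has_derivative_sc] by simp
  then have "((\<lambda>t. f (p + sc t e)) has_derivative (\<lambda>s. Df f (p + sc t e) (sc s e))) (at t)"
    by (rule has_derivative_compose[where g = f]) (rule holo_has_derivative[OF assms])
  then show ?thesis
    by (simp add: has_field_derivative_def holo_sc[OF assms] mult_commute_abs)
qed

lemma holo_add: "holo S f \<Longrightarrow> holo S g \<Longrightarrow> holo S (\<lambda>p. f p + g p)"
  by (rule holoI[where F = "\<lambda>p v. Df f p v + Df g p v"])
    (intro has_derivative_add holo_has_derivative | simp add: holo_sc algebra_simps)+

lemma holo_mult: "holo S f \<Longrightarrow> holo S g \<Longrightarrow> holo S (\<lambda>p. f p * g p)"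
  by (rule holoI[where F = "\<lambda>p v. f p * Df g p v + Df f p v * g p"])
    (intro has_derivative_mult holo_has_derivative | simp add: holo_sc algebra_simps)+

lemma holo_const: "holo S (\<lambda>p. c)"
  by (rule holoI[where F = "\<lambda>p v. 0"]) auto

lemma holo_cmult: "holo S f \<Longrightarrow> holo S (\<lambda>p. c * f p)"
  by (rule holo_mult[OF holo_const])

lemma holo_sum: "(\<And>i. i \<in> I \<Longrightarrow> holo S (f i)) \<Longrightarrow> holo S (\<lambda>p. \<Sum>i\<in>I. f i p)"
proof (induction I rule: infinite_finite_induct)
  case (insert x F) then show ?case by (simp add: holo_add)
qed (simp_all add: holo_const)

definition circle_point :: "real \<Rightarrow> real \<Rightarrow> complex" where
  "circle_point r x = of_real r * exp (2 * of_real pi * \<i> * of_real x)"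

lemma continuous_on_circle_point [continuous_intros]: "continuous_on S f \<Longrightarrow> continuous_on S (\<lambda>x. circle_point r (f x))"
  unfolding circle_point_def by (intro continuous_intros)

lemma norm_circle_point: "r > 0 \<Longrightarrow> norm (circle_point r x) = r"
  by (simp add: circle_point_def norm_mult)

lemma circle_point_nonzero: "r > 0 \<Longrightarrow> circle_point r x \<noteq> 0"
  by (simp add: circle_point_def)

text \<open>Cauchy's formula for the derivative, on the complex line through \<open>p\<close> in direction \<open>e\<close>. It expresses
  \<open>Df f p e\<close> by values of \<open>f\<close> alone, so regularity of \<open>f\<close> in \<open>p\<close> passes to the directional derivative.\<close>

lemma Df_Cauchy:
  assumes f: "holo S f" and r: "r > 0" and sub: "\<And>t. norm t \<le> r \<Longrightarrow> p + sc t e \<in> S"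
  shows "Df f p e = integral {0..1}
    (\<lambda>x. f (p + sc (circle_point r x) e) / circle_point r x)"
proof -
  define \<phi> where "\<phi> t = f (p + sc t e)" for t
  have d: "(\<phi> has_field_derivative Df f (p + sc t e) e) (at t)" if "norm t \<le> r" for t
    unfolding \<phi>_def by (rule holo_line[OF f sub[OF that]])
  have "continuous_on (cball 0 r) \<phi>"
    using d by (meson DERIV_isCont continuous_at_imp_continuous_on mem_cball_0)
  moreover have "\<phi> holomorphic_on ball 0 r"
    by (rule holomorphic_onI) (meson d field_differentiable_at_within field_differentiable_def mem_ball_0 less_imp_le)
  ultimately have "(\<phi> has_field_derivative (1 / (2 * of_real pi * \<i>) * contour_integral(circlepath 0 r) (\<lambda>u. \<phi> u / (u-0)^2))) (at 0)"
    using r by (intro Cauchy_derivative_integral_circlepath) auto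
  then have "Df f p e = 1 / (2 * of_real pi * \<i>) * contour_integral(circlepath 0 r) (\<lambda>u. \<phi> u / (u-0)^2)"
    using d[of 0] r DERIV_unique by (metis (no_types, lifting) add.right_neutral norm_zero less_imp_le scale_zero_left)
  also have "\<dots> = integral {0..1} (\<lambda>x. 1 / (2 * of_real pi * \<i>) * (\<phi> (circlepath 0 r x) / (circlepath 0 r x)^2 * vector_derivative (circlepath 0 r) (at x)))"
    by (simp only: contour_integral_integral integral_mult_right diff_zero)
  also have "\<dots> = integral {0..1} (\<lambda>x. \<phi> (circle_point r x) / circle_point r x)"
  proof (rule integral_cong)
    fix x
    have "circlepath 0 r x = circle_point r x"
      unfolding circlepath circle_point_def by simp
    moreover have "vector_derivative (circlepath 0 r) (at x) = 2 * of_real pi * \<i> * circle_point r x"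
      unfolding vector_derivative_circlepath circle_point_def by simp
    ultimately show "1 / (2 * of_real pi * \<i>) * (\<phi> (circlepath 0 r x) / (circlepath 0 r x)^2 * vector_derivative (circlepath 0 r) (at x)) = \<phi> (circle_point r x) / circle_point r x"
      using circle_point_nonzero[OF r, of x] by (simp add: power2_eq_square)
  qed
  finally show ?thesis unfolding \<phi>_def .
qed

text \<open>Discs of one radius fit into \<open>S\<close> for all base points near \<open>p\<close>.\<close>

lemma polydisc:
  assumes "open S" "p \<in> S"
  obtains r U where "r > 0" "open U" "convex U" "p \<in> U" "U \<subseteq> S" "\<And>q t. q \<in> U \<Longrightarrow> norm t \<le> r \<Longrightarrow> q + sc t e \<in> S"
proof -
  obtain \<delta> where \<delta>: "\<delta> > 0" "ball p \<delta> \<subseteq> S" using assms openE by blast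
  define K where "K = norm e + norm (sc \<i> e) + 1"
  have K: "K > 0" "norm (sc t e) \<le> norm t * K" for t
  proof -
    show "K > 0" unfolding K_def by (smt (verit) norm_ge_zero)
    have "norm (sc t e) \<le> \<bar>Re t\<bar> * norm e + \<bar>Im t\<bar> * norm (sc \<i> e)"
      by (subst sc_eq) (metis norm_scaleR norm_triangle_ineq)
    also have "\<dots> \<le> norm t * norm e + norm t * norm (sc \<i> e)"
      by (intro add_mono mult_right_mono abs_Re_le_cmod abs_Im_le_cmod) auto
    also have "\<dots> \<le> norm t * K" by (simp add: K_def algebra_simps)
    finally show "norm (sc t e) \<le> norm t * K" .
  qed
  show thesis
  proof
    show "\<delta> / (2 * K) > 0" using \<delta> K by simp
    show "ball p (\<delta>/2) \<subseteq> S" using \<delta> by (auto intro: subset_trans[OF subset_ball])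
    fix q and t :: complex assume q: "q \<in> ball p (\<delta>/2)" and t: "norm t \<le> \<delta> / (2 * K)"
    have "norm (sc t e) \<le> \<delta>/2"
      using K(2)[of t] mult_right_mono[OF t, of K] K(1) by (simp add: field_simps)
    then have "dist p (q + sc t e) < \<delta>"
      using q norm_triangle_ineq[of "q - p" "sc t e"] by (simp add: dist_norm norm_minus_commute algebra_simps)
    then show "q + sc t e \<in> S" using \<delta> by auto
  qed (use \<delta> in auto)
qed

lemma Df_continuous:
  assumes f: "holo S f" and S: "open S"
  shows "continuous_on S (\<lambda>p. Df f p e)"
proof (rule continuous_at_imp_continuous_on, rule ballI)
  fix p assume "p \<in> S"
  then obtain r U where U: "r > 0" "open U" "convex U" "p \<in> U" "U \<subseteq> S" "\<And>q t. q \<in> U \<Longrightarrow> norm t \<le> r \<Longrightarrow> q + sc t e \<in> S"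
    using polydisc[OF S] by metis
  have "continuous_on (U \<times> cbox 0 1) (\<lambda>(q, x). f (q + sc (circle_point r x) e) / circle_point r x)"
    unfolding case_prod_beta
    by (intro continuous_intros continuous_on_compose2[OF holo_continuous[OF f]])
      (auto simp: U norm_circle_point circle_point_nonzero)
  then have "continuous_on U (\<lambda>q. integral (cbox 0 1) (\<lambda>x. f (q + sc (circle_point r x) e) / circle_point r x))"
    by (rule integral_continuous_on_param)
  then have "continuous_on U (\<lambda>q. Df f q e)"
    by (rule continuous_on_eq) (simp add: Df_Cauchy[OF f U(1,6)])
  then show "isCont (\<lambda>q. Df f q e) p"
    using U continuous_on_eq_continuous_at by blast
qed

text \<open>Differentiating Cauchy's formula under the integral sign, which is legitimate because the first
  derivatives are already known to be continuous. The explicit integral is recorded: the two lemmas after this one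
  read complex linearity and symmetry off it.\<close>

lemma Df_differentiable:
  assumes f: "holo S f" and S: "open S" and p: "p \<in> S"
  obtains F r where "((\<lambda>p. Df f p e) has_derivative F) (at p)" "r > 0" "\<And>t. norm t \<le> r \<Longrightarrow> p + sc t e \<in> S"
    "\<And>v. F v = integral {0..1} (\<lambda>x. Df f (p + sc (circle_point r x) e) v / circle_point r x)"
proof -
  obtain r U where U: "r > 0" "open U" "convex U" "p \<in> U" "U \<subseteq> S" "\<And>q t. q \<in> U \<Longrightarrow> norm t \<le> r \<Longrightarrow> q + sc t e \<in> S"
    using polydisc[OF S p] by metis
  define fx where "fx q x = Blinfun (\<lambda>v. Df f (q + sc (circle_point r x) e) v / circle_point r x)" for q x
  have bl: "bounded_linear (\<lambda>v. Df f (q + sc (circle_point r x) e) v / circle_point r x)" if "q \<in> U" for q x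
    using has_derivative_bounded_linear[OF holo_has_derivative[OF f U(6)[OF that, of "circle_point r x"]]] U(1)
    by (simp add: norm_circle_point bounded_linear_divide bounded_linear_compose[OF bounded_linear_divide])
  have fx: "blinfun_apply (fx q x) v = Df f (q + sc (circle_point r x) e) v / circle_point r x" if "q \<in> U" for q x v
    unfolding fx_def by (simp add: bounded_linear_Blinfun_apply[OF bl[OF that]])
  have cont: "continuous_on (U \<times> cbox 0 1) (\<lambda>(q, x). fx q x)"
  proof (rule continuous_on_blinfun_componentwise)
    fix b :: 'a
    have "continuous_on (U \<times> cbox 0 1) (\<lambda>(q, x). Df f (q + sc (circle_point r x) e) b / circle_point r x)"
      unfolding case_prod_beta
      by (intro continuous_intros continuous_on_compose2[OF Df_continuous[OF f S]])
        (auto simp: U norm_circle_point circle_point_nonzero)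
    then show "continuous_on (U \<times> cbox 0 1) (\<lambda>y. blinfun_apply (case y of (q, x) \<Rightarrow> fx q x) b)"
      by (rule continuous_on_eq) (auto simp: fx)
  qed
  have der: "((\<lambda>q. f (q + sc (circle_point r x) e) / circle_point r x) has_derivative blinfun_apply (fx q x)) (at q within U)"
    if q: "q \<in> U" for q x
  proof -
    have "((\<lambda>q. q + sc (circle_point r x) e) has_derivative (\<lambda>v. v)) (at q within U)"
      by (auto intro!: derivative_eq_intros)
    then have "((\<lambda>q. f (q + sc (circle_point r x) e)) has_derivative (\<lambda>v. Df f (q + sc (circle_point r x) e) v)) (at q within U)"
      by (rule has_derivative_compose[where g = f])
        (rule holo_has_derivative[OF f U(6)], use q U(1) in \<open>simp_all add: norm_circle_point\<close>)
    then have "((\<lambda>q. f (q + sc (circle_point r x) e) / circle_point r x) has_derivative (\<lambda>v. Df f (q + sc (circle_point r x) e) v / circle_point r x)) (at q within U)"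
      by (rule bounded_linear.has_derivative[OF bounded_linear_divide])
    moreover have "(\<lambda>v. Df f (q + sc (circle_point r x) e) v / circle_point r x) = blinfun_apply (fx q x)"
      using fx[OF q] by auto
    ultimately show ?thesis by simp
  qed
  have int: "(\<lambda>x. f (q + sc (circle_point r x) e) / circle_point r x) integrable_on cbox 0 1" if "q \<in> U" for q
    by (intro integrable_continuous continuous_intros continuous_on_compose2[OF holo_continuous[OF f]])
      (use that in \<open>auto simp: U norm_circle_point circle_point_nonzero\<close>)
  have intfx: "fx p integrable_on cbox 0 1"
    by (rule integrable_continuous)
      (rule continuous_on_compose2[OF cont, of _ "\<lambda>x. (p, x)", simplified], auto intro!: continuous_intros U)
  have "((\<lambda>q. integral (cbox 0 1) (\<lambda>x. f (q + sc (circle_point r x) e) / circle_point r x)) has_derivative integral (cbox 0 1) (fx p)) (at p within U)"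
    by (rule leibniz_rule[OF der int cont U(4,3)])
  then have "((\<lambda>q. integral (cbox 0 1) (\<lambda>x. f (q + sc (circle_point r x) e) / circle_point r x)) has_derivative integral (cbox 0 1) (fx p)) (at p)"
    using at_within_open[OF U(4,2)] by simp
  then have "((\<lambda>q. Df f q e) has_derivative integral (cbox 0 1) (fx p)) (at p)"
    by (rule has_derivative_transform_within_open[OF _ U(2,4)]) (simp add: Df_Cauchy[OF f U(1,6)])
  moreover have "integral (cbox 0 1) (fx p) v = integral {0..1} (\<lambda>x. Df f (p + sc (circle_point r x) e) v / circle_point r x)" for v
    using integral_linear[OF intfx blinfun.bounded_linear_left[of v]] fx[OF U(4)] by (simp add: o_def)
  ultimately show thesis using U that by blast
qed

lemma holo_Df:
  assumes f: "holo S f" and S: "open S"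
  shows "holo S (\<lambda>p. Df f p e)"
  unfolding holo_def
proof
  fix p assume p: "p \<in> S"
  obtain F r where F: "((\<lambda>p. Df f p e) has_derivative F) (at p)" "r > 0" "\<And>t. norm t \<le> r \<Longrightarrow> p + sc t e \<in> S"
    "\<And>v. F v = integral {0..1} (\<lambda>x. Df f (p + sc (circle_point r x) e) v / circle_point r x)"
    by (rule Df_differentiable[OF f S p, of e]) (rule that; assumption)
  have "F (sc c v) = c * F v" for c v
  proof -
    have "(\<lambda>x. Df f (p + sc (circle_point r x) e) (sc c v) / circle_point r x) = (\<lambda>x. c * (Df f (p + sc (circle_point r x) e) v / circle_point r x))"
      using F(2,3) by (simp add: holo_sc[OF f] norm_circle_point)
    then show ?thesis unfolding F(4) by (simp only: integral_mult_right)
  qed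
  with F(1) show "\<exists>F. ((\<lambda>p. Df f p e) has_derivative F) (at p) \<and> (\<forall>c v. F (sc c v) = c * F v)"
    by blast
qed

text \<open>By Cauchy's formula the derivative of \<open>Df f _ e\<close> in direction \<open>v\<close> is an average of \<open>Df f _ v\<close> over a
  circle in direction \<open>e\<close>; by the same formula, applied to \<open>Df f _ v\<close>, this average is the derivative of
  \<open>Df f _ v\<close> in direction \<open>e\<close>.\<close>

lemma Df_symmetric:
  assumes f: "holo S f" and S: "open S" and p: "p \<in> S"
  shows "Df (\<lambda>q. Df f q e) p v = Df (\<lambda>q. Df f q v) p e"
proof -
  obtain F r where F: "((\<lambda>p. Df f p e) has_derivative F) (at p)" "r > 0" "\<And>t. norm t \<le> r \<Longrightarrow> p + sc t e \<in> S"
    "\<And>v. F v = integral {0..1} (\<lambda>x. Df f (p + sc (circle_point r x) e) v / circle_point r x)"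
    by (rule Df_differentiable[OF f S p, of e]) (rule that; assumption)
  have "Df (\<lambda>q. Df f q e) p v = F v"
    using frechet_derivative_at[OF F(1)] by simp
  also have "\<dots> = Df (\<lambda>q. Df f q v) p e"
    unfolding F(4) using Df_Cauchy[OF holo_Df[OF f S] F(2,3)] by simp
  finally show ?thesis .
qed

section \<open>First-order operators\<close>

lemma linear_expand:
  fixes F :: "'a \<Rightarrow> complex"
  assumes "linear F" shows "F u = (\<Sum>b\<in>Basis. (u \<bullet> b) *\<^sub>R F b)"
proof -
  have "F u = F (\<Sum>b\<in>Basis. (u \<bullet> b) *\<^sub>R b)" by (simp add: euclidean_representation)
  also have "\<dots> = (\<Sum>b\<in>Basis. (u \<bullet> b) *\<^sub>R F b)"
    by (simp only: linear_sum[OF assms] linear_scale[OF assms])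
  finally show ?thesis .
qed

text \<open>A product rule: expand \<open>v\<close> in a real basis and differentiate term by term. The symmetry of second
  derivatives recombines the terms in which \<open>f\<close> is differentiated twice.\<close>

lemma Df_along_field:
  assumes f: "holo S f" and S: "open S" and p: "p \<in> S" and v: "(v has_derivative v') (at p)"
  shows "((\<lambda>q. Df f q (v q)) has_derivative (\<lambda>u. Df f p (v' u) + Df (\<lambda>q. Df f q (v p)) p u)) (at p)"
proof -
  have "((\<lambda>q. \<Sum>b\<in>Basis. (v q \<bullet> b) *\<^sub>R Df f q b) has_derivative
      (\<lambda>u. \<Sum>b\<in>Basis. (v p \<bullet> b) *\<^sub>R Df (\<lambda>q. Df f q b) p u + (v' u \<bullet> b) *\<^sub>R Df f p b)) (at p)"
    by (intro has_derivative_sum has_derivative_scaleR has_derivative_inner_left v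
        holo_has_derivative[OF holo_Df[OF f S] p])
  then have "((\<lambda>q. Df f q (v q)) has_derivative
      (\<lambda>u. \<Sum>b\<in>Basis. (v p \<bullet> b) *\<^sub>R Df (\<lambda>q. Df f q b) p u + (v' u \<bullet> b) *\<^sub>R Df f p b)) (at p)"
    by (rule has_derivative_transform_within_open[OF _ S p]) (simp flip: linear_expand[OF holo_linear[OF f]])
  moreover have "(\<Sum>b\<in>Basis. (v p \<bullet> b) *\<^sub>R Df (\<lambda>q. Df f q b) p u + (v' u \<bullet> b) *\<^sub>R Df f p b)
      = Df f p (v' u) + Df (\<lambda>q. Df f q (v p)) p u" for u
  proof -
    have "(\<Sum>b\<in>Basis. (v p \<bullet> b) *\<^sub>R Df (\<lambda>q. Df f q b) p u) = (\<Sum>b\<in>Basis. (v p \<bullet> b) *\<^sub>R Df (\<lambda>q. Df f q u) p b)"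
      by (simp add: Df_symmetric[OF f S p, of _ u])
    also have "\<dots> = Df (\<lambda>q. Df f q u) p (v p)"
      by (rule linear_expand[OF holo_linear[OF holo_Df[OF f S] p], symmetric])
    also have "\<dots> = Df (\<lambda>q. Df f q (v p)) p u"
      by (rule Df_symmetric[OF f S p])
    finally show ?thesis
      by (simp add: sum.distrib flip: linear_expand[OF holo_linear[OF f p]])
  qed
  ultimately show ?thesis by simp
qed

definition holo_field :: "'a set \<Rightarrow> ('a \<Rightarrow> 'a) \<Rightarrow> bool" where
  "holo_field S v \<longleftrightarrow> (\<forall>p\<in>S. \<exists>F. (v has_derivative F) (at p) \<and> (\<forall>c u. F (sc c u) = sc c (F u)))"

definition first_order :: "('a \<Rightarrow> 'a) \<Rightarrow> ('a \<Rightarrow> complex) \<Rightarrow> ('a \<Rightarrow> complex) \<Rightarrow> 'a \<Rightarrow> complex" where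
  "first_order v b f p = Df f p (v p) + b p * f p"

lemma holo_first_order:
  assumes f: "holo S f" and S: "open S" and v: "holo_field S v" and b: "holo S b"
  shows "holo S (first_order v b f)"
proof -
  have "holo S (\<lambda>q. Df f q (v q))"
    unfolding holo_def
  proof
    fix p assume p: "p \<in> S"
    then obtain F where F: "(v has_derivative F) (at p)" "\<And>c u. F (sc c u) = sc c (F u)"
      using v unfolding holo_field_def by blast
    show "\<exists>F. ((\<lambda>q. Df f q (v q)) has_derivative F) (at p) \<and> (\<forall>c v. F (sc c v) = c * F v)"
      by (intro exI conjI allI, rule Df_along_field[OF f S p F(1)])
        (simp add: F(2) holo_sc[OF f p] holo_sc[OF holo_Df[OF f S] p] algebra_simps)
  qed
  then show ?thesis
    unfolding first_order_def[abs_def] by (intro holo_add holo_mult b f)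
qed

lemma Df_first_order:
  assumes f: "holo S f" and S: "open S" and p: "p \<in> S"
    and v: "(v has_derivative v') (at p)" and b: "(b has_derivative b') (at p)"
  shows "Df (first_order v b f) p u = Df f p (v' u) + Df (\<lambda>q. Df f q (v p)) p u + (b p * Df f p u + b' u * f p)"
proof -
  have "(first_order v b f has_derivative (\<lambda>u. Df f p (v' u) + Df (\<lambda>q. Df f q (v p)) p u + (b p * Df f p u + b' u * f p))) (at p)"
    unfolding first_order_def[abs_def]
    by (intro has_derivative_add Df_along_field[OF f S p v] has_derivative_mult b holo_has_derivative[OF f p])
  from frechet_derivative_at[OF this] show ?thesis by (metis (no_types, lifting))
qed

text \<open>The second derivatives of \<open>f\<close> cancel by symmetry; what is left is the Lie bracket of the fields and
  the difference of the derivatives of the potentials.\<close>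

lemma first_order_commutator:
  assumes f: "holo S f" and S: "open S" and p: "p \<in> S"
    and v: "(v has_derivative v') (at p)" and b: "(b has_derivative b') (at p)"
    and w: "(w has_derivative w') (at p)" and c: "(c has_derivative c') (at p)"
  shows "first_order v b (first_order w c f) p - first_order w c (first_order v b f) p
    = Df f p (w' (v p) - v' (w p)) + (c' (v p) - b' (w p)) * f p"
  unfolding first_order_def[of _ _ "first_order _ _ _"] Df_first_order[OF f S p v b] Df_first_order[OF f S p w c]
    Df_symmetric[OF f S p, of "w p" "v p"] linear_diff[OF holo_linear[OF f p]]
  by (simp add: first_order_def algebra_simps)

text \<open>The chain rule turns the derivative of the pullback along \<open>v\<close> into the derivative of \<open>f\<close> along the
  pushed-forward field; the factor \<open>J\<close> contributes to the potential through its logarithmic derivative.\<close>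

lemma first_order_pullback:
  assumes f: "holo S f" and p: "\<Phi> p \<in> S"
    and \<Phi>: "(\<Phi> has_derivative \<Phi>') (at p)" and J: "(J has_derivative J') (at p)"
    and v: "\<Phi>' (v p) = sc \<mu> (v (\<Phi> p))"
    and b: "J' (v p) + b p * J p = \<mu> * J p * b (\<Phi> p)"
  shows "first_order v b (\<lambda>q. J q * f (\<Phi> q)) p = \<mu> * J p * first_order v b f (\<Phi> p)"
proof -
  have "((\<lambda>q. f (\<Phi> q)) has_derivative (\<lambda>u. Df f (\<Phi> p) (\<Phi>' u))) (at p)"
    by (rule has_derivative_compose[where g = f, OF \<Phi>]) (rule holo_has_derivative[OF f p])
  from has_derivative_mult[OF J this]
  have "Df (\<lambda>q. J q * f (\<Phi> q)) p = (\<lambda>u. J p * Df f (\<Phi> p) (\<Phi>' u) + J' u * f (\<Phi> p))"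
    by (rule frechet_derivative_at[symmetric])
  then have "first_order v b (\<lambda>q. J q * f (\<Phi> q)) p = J p * (\<mu> * Df f (\<Phi> p) (v (\<Phi> p))) + (J' (v p) + b p * J p) * f (\<Phi> p)"
    by (simp add: first_order_def v holo_sc[OF f p] algebra_simps)
  then show ?thesis
    unfolding b by (simp add: first_order_def algebra_simps)
qed

lemma first_order_sum:
  assumes f: "\<And>i. i \<in> I \<Longrightarrow> holo S (f i)" and p: "p \<in> S"
  shows "first_order v b (\<lambda>q. \<Sum>i\<in>I. c i * f i q) p = (\<Sum>i\<in>I. c i * first_order v b (f i) p)"
proof -
  have "((\<lambda>q. \<Sum>i\<in>I. c i * f i q) has_derivative (\<lambda>u. \<Sum>i\<in>I. c i * Df (f i) p u)) (at p)"
    by (intro has_derivative_sum has_derivative_mult_right holo_has_derivative[OF f p])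
  from frechet_derivative_at[OF this, symmetric] show ?thesis
    by (simp add: first_order_def sum_distrib_left sum.distrib algebra_simps)
qed

end

section \<open>The raising and lowering operators as first-order operators\<close>

type_synonym 'n point = "(complex ^ 'n) \<times> (complex ^ 'n) \<times> complex \<times> complex"

definition cscale :: "complex \<Rightarrow> ('n::finite) point \<Rightarrow> 'n point" where
  "cscale c = (\<lambda>(x, y, s, t). (c *s x, c *s y, c * s, c * t))"

interpretation jac: complex_space cscale
proof
  show "cscale (complex_of_real r) x = r *\<^sub>R x" for r and x :: "('n::finite) point"
    by (simp add: cscale_def split_beta prod_eq_iff vec_eq_iff scaleR_conv_of_real[symmetric])
qed (auto simp: cscale_def split_beta prod_eq_iff vec_eq_iff algebra_simps)

definition cdomain :: "('n::finite) point set" where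
  "cdomain = {(z, \<zeta>, \<tau>, w). (\<tau>, w) \<in> half_pairs}"

abbreviation "zC p \<equiv> fst p"
abbreviation "zetaC p \<equiv> fst (snd p)"
abbreviation "tauC p \<equiv> fst (snd (snd p))"
abbreviation "wC p \<equiv> snd (snd (snd p))"

lemma cdomain_iff: "p \<in> cdomain \<longleftrightarrow> Im (tauC p) > 0 \<and> Im (wC p) > 0 \<and> tauC p \<noteq> wC p"
  by (cases p) (auto simp: cdomain_def half_pairs_def)

lemma open_cdomain: "open (cdomain :: ('n::finite) point set)"
proof -
  have "open {p :: 'n point. Im (tauC p) > 0 \<and> Im (wC p) > 0 \<and> tauC p \<noteq> wC p}"
    by (intro open_Collect_conj open_Collect_less open_Collect_neq continuous_intros)
  then show ?thesis
    by (simp add: cdomain_iff[symmetric])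
qed

lemma has_derivative_vector_scalar_mult [derivative_intros]:
  fixes g :: "'a::real_normed_vector \<Rightarrow> complex ^ 'n::finite"
  assumes f: "(f has_derivative f') (at x within S)" and g: "(g has_derivative g') (at x within S)"
  shows "((\<lambda>x. f x *s g x) has_derivative (\<lambda>h. f x *s g' h + f' h *s g x)) (at x within S)"
proof -
  have "bilinear ((*s) :: complex \<Rightarrow> complex ^ 'n \<Rightarrow> complex ^ 'n)"
    by (auto simp: bilinear_def vec_eq_iff algebra_simps intro!: linearI)
  from bounded_bilinear.FDERIV[OF bilinear_conv_bounded_bilinear[THEN iffD1, OF this] f g]
  show ?thesis .
qed

lemma bform_add_left: "bform A (x + y) z = bform A x z + bform A y z"
  and bform_add_right: "bform A z (x + y) = bform A z x + bform A z y"
  and bform_diff_left: "bform A (x - y) z = bform A x z - bform A y z"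
  and bform_diff_right: "bform A z (x - y) = bform A z x - bform A z y"
  and bform_scale_left: "bform A (c *s x) z = c * bform A x z"
  and bform_scale_right: "bform A z (c *s x) = c * bform A z x"
  and bform_zero_left: "bform A 0 z = 0"
  and bform_zero_right: "bform A z 0 = 0"
  and bform_minus_left: "bform A (- x) z = - bform A x z"
  and bform_minus_right: "bform A z (- x) = - bform A z x"
  by (simp_all add: bform_def sum.distrib sum_subtractf sum_distrib_left algebra_simps flip: sum_negf)

lemmas bform_simps = bform_add_left bform_add_right bform_diff_left bform_diff_right
  bform_scale_left bform_scale_right bform_zero_left bform_zero_right
  bform_minus_left bform_minus_right

lemma bform_scaleR: "bform A (r *\<^sub>R x) z = r *\<^sub>R bform A x z" "bform A z (r *\<^sub>R x) = r *\<^sub>R bform A z x"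
  by (simp_all add: bform_def scaleR_sum_right)

lemma bform_commute:
  assumes "transpose A = A" shows "bform A x y = bform A y x"
proof -
  have "A $ \<alpha> $ \<beta> = A $ \<beta> $ \<alpha>" for \<alpha> \<beta>
    by (subst assms[symmetric]) (simp add: transpose_def)
  then show ?thesis
    unfolding bform_def by (subst sum.swap) (simp add: mult_ac)
qed

lemma bform_axis: "bform A (axis \<alpha> 1) x = (map_matrix of_int A *v x) $ \<alpha>"
proof -
  have "bform A (axis \<alpha> 1) x = (\<Sum>\<gamma>\<in>UNIV. if \<gamma> = \<alpha> then \<Sum>\<beta>\<in>UNIV. of_int (A $ \<alpha> $ \<beta>) * x $ \<beta> else 0)"
    unfolding bform_def by (rule sum.cong) (auto simp: axis_def)
  then show ?thesis by (simp add: matrix_vector_mult_def map_matrix_def)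
qed

lemma bform_axis_axis: "bform A (axis \<alpha> 1) (axis \<beta> 1) = of_int (A $ \<alpha> $ \<beta>)"
  unfolding bform_axis by (simp add: matrix_vector_mult_def map_matrix_def axis_def if_distrib cong: if_cong)

lemma has_derivative_bform [derivative_intros]:
  assumes f: "(f has_derivative f') (at x within S)" and g: "(g has_derivative g') (at x within S)"
  shows "((\<lambda>x. bform A (f x) (g x)) has_derivative (\<lambda>h. bform A (f x) (g' h) + bform A (f' h) (g x))) (at x within S)"
proof -
  have "bilinear (bform A)"
    by (auto simp: bilinear_def bform_simps bform_scaleR intro!: linearI)
  from bounded_bilinear.FDERIV[OF bilinear_conv_bounded_bilinear[THEN iffD1, OF this] f g]
  show ?thesis .
qed

text \<open>The fields and potentials of the operators. The parameters \<open>\<kappa>\<close> (a complex weight) and \<open>\<epsilon>\<close>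
  absorb the shift by \<open>r / 2\<close> that results from splitting off the power of \<open>\<i>(w - \<tau>)\<close>.\<close>

definition fieldR :: "('n::finite) point \<Rightarrow> 'n point" where
  "fieldR p = ((1 / (tauC p - wC p)) *s (zC p - zetaC p), 0, 1, 0)"
definition potR :: "int ^ ('n::finite) ^ 'n \<Rightarrow> complex \<Rightarrow> 'n point \<Rightarrow> complex" where
  "potR A \<kappa> p = 2 * of_real pi * \<i> * qform A ((1 / (tauC p - wC p)) *s (zC p - zetaC p)) + \<kappa> / (tauC p - wC p)"
definition fieldL :: "('n::finite) point \<Rightarrow> 'n point" where
  "fieldL p = (0, (tauC p - wC p) *s (zC p - zetaC p), 0, (tauC p - wC p)\<^sup>2)"
definition potL :: "complex \<Rightarrow> ('n::finite) point \<Rightarrow> complex" where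
  "potL \<epsilon> p = \<epsilon> * (tauC p - wC p)"
definition fieldD :: "'n \<Rightarrow> ('n::finite) point \<Rightarrow> 'n point" where
  "fieldD \<alpha> p = (axis \<alpha> 1, 0, 0, 0)"
definition potD :: "int ^ ('n::finite) ^ 'n \<Rightarrow> 'n \<Rightarrow> 'n point \<Rightarrow> complex" where
  "potD A \<alpha> p = 2 * of_real pi * \<i> / (tauC p - wC p) * bform A (axis \<alpha> 1) (zC p - zetaC p)"
definition fieldd :: "'n \<Rightarrow> ('n::finite) point \<Rightarrow> 'n point" where
  "fieldd \<alpha> p = (0, (tauC p - wC p) *s axis \<alpha> 1, 0, 0)"

text \<open>Derivatives at \<open>p\<close> of the fields and potentials, as functions of the direction \<open>u\<close>.\<close>

definition fieldR' :: "('n::finite) point \<Rightarrow> 'n point \<Rightarrow> 'n point" where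
  "fieldR' p u = ((1 / (tauC p - wC p)) *s (zC u - zetaC u)
     - ((tauC u - wC u) / (tauC p - wC p)\<^sup>2) *s (zC p - zetaC p), 0, 0, 0)"
definition potR' :: "int ^ ('n::finite) ^ 'n \<Rightarrow> complex \<Rightarrow> 'n point \<Rightarrow> 'n point \<Rightarrow> complex" where
  "potR' A \<kappa> p u = 2 * of_real pi * \<i> * (bform A (zC p - zetaC p) (zC u - zetaC u) / (tauC p - wC p)\<^sup>2
     - 2 * qform A (zC p - zetaC p) * (tauC u - wC u) / (tauC p - wC p) ^ 3)
     - \<kappa> * (tauC u - wC u) / (tauC p - wC p)\<^sup>2"
definition fieldL' :: "('n::finite) point \<Rightarrow> 'n point \<Rightarrow> 'n point" where
  "fieldL' p u = (0, (tauC u - wC u) *s (zC p - zetaC p) + (tauC p - wC p) *s (zC u - zetaC u), 0,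
     2 * (tauC p - wC p) * (tauC u - wC u))"
definition potD' :: "int ^ ('n::finite) ^ 'n \<Rightarrow> 'n \<Rightarrow> 'n point \<Rightarrow> 'n point \<Rightarrow> complex" where
  "potD' A \<alpha> p u = 2 * of_real pi * \<i> * (bform A (axis \<alpha> 1) (zC u - zetaC u) / (tauC p - wC p)
     - bform A (axis \<alpha> 1) (zC p - zetaC p) * (tauC u - wC u) / (tauC p - wC p)\<^sup>2)"

lemma inverse_diff_deriv:
  assumes "p \<in> cdomain"
  shows "((\<lambda>p. c / (tauC p - wC p)) has_derivative (\<lambda>u. - c * (tauC u - wC u) / (tauC p - wC p)\<^sup>2)) (at p)"
proof -
  have "((\<lambda>l. c / l) has_field_derivative - c / (tauC p - wC p)\<^sup>2) (at (tauC p - wC p))"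
    using assms by (auto intro!: derivative_eq_intros simp: cdomain_iff power2_eq_square)
  moreover have "((\<lambda>p. tauC p - wC p) has_derivative (\<lambda>u. tauC u - wC u)) (at p)"
    by (intro derivative_intros)
  ultimately have "((\<lambda>p. c / (tauC p - wC p)) has_derivative (\<lambda>u. - c / (tauC p - wC p)\<^sup>2 * (tauC u - wC u))) (at p)"
    unfolding has_field_derivative_def by (rule has_derivative_compose[rotated])
  then show ?thesis by simp
qed

lemma fieldR_deriv:
  assumes "p \<in> cdomain" shows "(fieldR has_derivative fieldR' p) (at p)"
  unfolding fieldR_def[abs_def]
proof (rule has_derivative_eq_rhs)
  show "((\<lambda>p. ((1 / (tauC p - wC p)) *s (zC p - zetaC p), 0, 1, 0)) has_derivative
    (\<lambda>u. ((1 / (tauC p - wC p)) *s (zC u - zetaC u) + (- 1 * (tauC u - wC u) / (tauC p - wC p)\<^sup>2) *s (zC p - zetaC p), 0, 0, 0))) (at p)"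
    by (intro derivative_intros inverse_diff_deriv assms)
qed (simp add: fun_eq_iff fieldR'_def vec_eq_iff algebra_simps diff_divide_distrib)

lemma potR_deriv:
  assumes "p \<in> cdomain" "transpose A = A" shows "(potR A \<kappa> has_derivative potR' A \<kappa> p) (at p)"
  unfolding potR_def[abs_def]
proof (rule has_derivative_eq_rhs)
  let ?v = "\<lambda>p. (1 / (tauC p - wC p)) *s (zC p - zetaC p)"
  let ?v' = "\<lambda>u. ((1 / (tauC p - wC p)) *s (zC u - zetaC u) + (- 1 * (tauC u - wC u) / (tauC p - wC p)\<^sup>2) *s (zC p - zetaC p))"
  have "((\<lambda>p. bform A (?v p) (?v p) / 2) has_derivative (\<lambda>u. (bform A (?v p) (?v' u) + bform A (?v' u) (?v p)) / 2)) (at p)"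
    by (intro bounded_linear.has_derivative[OF bounded_linear_divide] derivative_intros inverse_diff_deriv assms)
  then show "((\<lambda>p. 2 * of_real pi * \<i> * qform A (?v p) + \<kappa> / (tauC p - wC p)) has_derivative
    (\<lambda>u. 2 * of_real pi * \<i> * ((bform A (?v p) (?v' u) + bform A (?v' u) (?v p)) / 2) + - \<kappa> * (tauC u - wC u) / (tauC p - wC p)\<^sup>2)) (at p)"
    unfolding qform_def
    by (intro has_derivative_add has_derivative_mult_right inverse_diff_deriv assms)
  show "(\<lambda>u. 2 * of_real pi * \<i> * ((bform A (?v p) (?v' u) + bform A (?v' u) (?v p)) / 2) + - \<kappa> * (tauC u - wC u) / (tauC p - wC p)\<^sup>2)
    = potR' A \<kappa> p"
  proof
    fix u
    define l where "l = tauC p - wC p"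
    have l: "l \<noteq> 0" using assms(1) by (simp add: l_def cdomain_iff)
    show "2 * of_real pi * \<i> * ((bform A (?v p) (?v' u) + bform A (?v' u) (?v p)) / 2) + - \<kappa> * (tauC u - wC u) / (tauC p - wC p)\<^sup>2
      = potR' A \<kappa> p u"
      unfolding bform_commute[OF assms(2), of "?v' u"]
      unfolding potR'_def qform_def l_def[symmetric] bform_scale_left bform_scale_right bform_add_right
      using l by (simp add: power2_eq_square power3_eq_cube field_simps)
  qed
qed

lemma fieldL_deriv: "(fieldL has_derivative fieldL' p) (at p)"
  unfolding fieldL_def[abs_def]
  by (rule has_derivative_eq_rhs, (rule derivative_intros)+)
    (simp add: fieldL'_def fun_eq_iff vec_eq_iff algebra_simps)

lemma potL_deriv: "(potL \<epsilon> has_derivative (\<lambda>u. \<epsilon> * (tauC u - wC u))) (at p)"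
  unfolding potL_def[abs_def] by (intro derivative_intros)

lemma fieldD_deriv: "(fieldD \<alpha> has_derivative (\<lambda>u. 0)) (at p)"
  unfolding fieldD_def[abs_def] by (rule has_derivative_const)

lemma potD_deriv:
  assumes "p \<in> cdomain" shows "(potD A \<alpha> has_derivative potD' A \<alpha> p) (at p)"
  unfolding potD_def[abs_def]
  by (rule has_derivative_eq_rhs, (rule inverse_diff_deriv derivative_intros assms)+)
    (simp add: potD'_def fun_eq_iff bform_zero_left algebra_simps diff_divide_distrib add_divide_distrib)

lemma fieldd_deriv: "(fieldd \<alpha> has_derivative (\<lambda>u. (0, (tauC u - wC u) *s axis \<alpha> 1, 0, 0))) (at p)"
  unfolding fieldd_def[abs_def]
  by (rule has_derivative_eq_rhs, (rule derivative_intros)+) (simp add: fun_eq_iff vec_eq_iff)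

lemma fieldR'_cscale: "fieldR' p (cscale c u) = cscale c (fieldR' p u)"
  by (simp add: cscale_def split_beta fieldR'_def vec_eq_iff algebra_simps)

lemma fieldL'_cscale: "fieldL' p (cscale c u) = cscale c (fieldL' p u)"
  by (simp add: cscale_def split_beta fieldL'_def vec_eq_iff algebra_simps)

lemma holo_fields:
  "jac.holo_field cdomain fieldR" "jac.holo_field cdomain fieldL" "jac.holo_field cdomain (fieldD \<alpha>)" "jac.holo_field cdomain (fieldd \<alpha>)"
  unfolding jac.holo_field_def
proof -
  show "\<forall>p\<in>cdomain. \<exists>F. (fieldR has_derivative F) (at p) \<and> (\<forall>c u. F (cscale c u) = cscale c (F u))"
    using fieldR_deriv fieldR'_cscale by blast
  show "\<forall>p\<in>cdomain. \<exists>F. (fieldL has_derivative F) (at p) \<and> (\<forall>c u. F (cscale c u) = cscale c (F u))"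
    using fieldL_deriv fieldL'_cscale by blast
  show "\<forall>p\<in>cdomain. \<exists>F. (fieldD \<alpha> has_derivative F) (at p) \<and> (\<forall>c u. F (cscale c u) = cscale c (F u))"
    using fieldD_deriv jac.scale_zero_right by metis
  show "\<forall>p\<in>cdomain. \<exists>F. (fieldd \<alpha> has_derivative F) (at p) \<and> (\<forall>c u. F (cscale c u) = cscale c (F u))"
    by (intro ballI exI conjI allI, rule fieldd_deriv) (auto simp: cscale_def split_beta vec_eq_iff algebra_simps)
qed

lemma holo_potR: "transpose A = A \<Longrightarrow> jac.holo cdomain (potR A \<kappa>)"
  by (rule jac.holoI, erule (1) potR_deriv) (simp add: cscale_def split_beta potR'_def bform_simps algebra_simps diff_divide_distrib)

lemma holo_potL: "jac.holo cdomain (potL \<epsilon>)"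
  by (rule jac.holoI, rule potL_deriv) (simp add: cscale_def split_beta algebra_simps)

lemma holo_potD: "jac.holo cdomain (potD A \<alpha>)"
  by (rule jac.holoI, erule potD_deriv) (simp add: cscale_def split_beta potD'_def bform_simps algebra_simps diff_divide_distrib)

lemma potR_shift:
  "jac.first_order fieldR (potR A (\<kappa> + c)) f p = jac.first_order fieldR (potR A \<kappa>) f p + c / (tauC p - wC p) * f p"
  by (simp add: jac.first_order_def potR_def add_divide_distrib algebra_simps)

text \<open>The commutation relations. Each is \<open>first_order_commutator\<close> together with an evaluation of the bracket and of
  the potential; \<open>potR_shift\<close> accounts for the change of weight.\<close>

context
  fixes A :: "int ^ ('n::finite) ^ 'n" and f :: "'n point \<Rightarrow> complex" and p :: "'n point"
  assumes A: "transpose A = A" and f: "jac.holo cdomain f" and p: "p \<in> cdomain"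
begin

lemma diff_nonzero: "tauC p - wC p \<noteq> 0"
  using p by (simp add: cdomain_iff)

text \<open>The bracket of \<open>L\<close> and \<open>R\<close> is \<open>- 2 / (\<tau> - w)\<close> times the field of \<open>L\<close>. Lowering the weight of the second \<open>R\<close> by
  2 adds \<open>2 / (\<tau> - w)\<close> times the whole operator \<open>L\<close>, so the field cancels and the potential of \<open>L\<close> contributes
  \<open>2 * \<epsilon>\<close>.\<close>

lemma commutator_LR:
  "jac.first_order fieldL (potL \<epsilon>) (jac.first_order fieldR (potR A \<kappa>) f) p
    - jac.first_order fieldR (potR A (\<kappa> - 2)) (jac.first_order fieldL (potL \<epsilon>) f) p = (\<kappa> + \<epsilon>) * f p"
proof -
  define l where "l = tauC p - wC p"
  have l: "l \<noteq> 0" using diff_nonzero by (simp add: l_def)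
  have "fieldR' p (fieldL p) - fieldL' p (fieldR p) = cscale (- 2 / l) (fieldL p)"
    unfolding fieldR'_def fieldL'_def fieldR_def fieldL_def cscale_def l_def[symmetric]
    using l by (simp add: vec_eq_iff power2_eq_square field_simps)
  note vec = this
  have scal: "potR' A \<kappa> p (fieldL p) - \<epsilon> * (tauC (fieldR p) - wC (fieldR p)) = \<kappa> - \<epsilon>"
    unfolding potR'_def fieldR_def fieldL_def qform_def l_def[symmetric]
    using l by (simp add: bform_simps power2_eq_square power3_eq_cube field_simps)
  have comm: "jac.first_order fieldL (potL \<epsilon>) (jac.first_order fieldR (potR A \<kappa>) f) p - jac.first_order fieldR (potR A \<kappa>) (jac.first_order fieldL (potL \<epsilon>) f) p
      = - 2 / l * Df f p (fieldL p) + (\<kappa> - \<epsilon>) * f p"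
    unfolding jac.first_order_commutator[OF f open_cdomain p fieldL_deriv potL_deriv fieldR_deriv[OF p] potR_deriv[OF p A]]
      vec scal jac.holo_sc[OF f p] by (rule refl)
  have shift: "jac.first_order fieldR (potR A (\<kappa> - 2)) (jac.first_order fieldL (potL \<epsilon>) f) p
      = jac.first_order fieldR (potR A \<kappa>) (jac.first_order fieldL (potL \<epsilon>) f) p - 2 / l * Df f p (fieldL p) - 2 * \<epsilon> * f p"
    using potR_shift[of A \<kappa> "- 2" "jac.first_order fieldL (potL \<epsilon>) f" p] l
    by (simp add: jac.first_order_def[of fieldL _ f] potL_def algebra_simps flip: l_def)
  show ?thesis
    unfolding comm[unfolded diff_eq_eq] shift by (simp add: algebra_simps)
qed

lemma commutator_dR:
  "jac.first_order (fieldd \<alpha>) (\<lambda>p. 0) (jac.first_order fieldR (potR A \<kappa>) f) p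
    - jac.first_order fieldR (potR A (\<kappa> - 1)) (jac.first_order (fieldd \<alpha>) (\<lambda>p. 0) f) p = - jac.first_order (fieldD \<alpha>) (potD A \<alpha>) f p"
proof -
  define l where "l = tauC p - wC p"
  have l: "l \<noteq> 0" using diff_nonzero by (simp add: l_def)
  have "fieldR' p (fieldd \<alpha> p) - (0, (tauC (fieldR p) - wC (fieldR p)) *s axis \<alpha> 1, 0, 0)
      = - fieldD \<alpha> p - cscale (1 / l) (fieldd \<alpha> p)"
    unfolding fieldR'_def fieldd_def fieldR_def fieldD_def cscale_def l_def[symmetric]
    using l by (simp add: vec_eq_iff)
  moreover have "potR' A \<kappa> p (fieldd \<alpha> p) - 0 = - potD A \<alpha> p"
    unfolding potR'_def fieldd_def potD_def l_def[symmetric] bform_commute[OF A, of "axis \<alpha> 1"]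
    using l by (simp add: bform_simps power2_eq_square)
  ultimately show ?thesis
    using jac.first_order_commutator[OF f open_cdomain p fieldd_deriv has_derivative_const fieldR_deriv[OF p] potR_deriv[OF p A], of \<alpha> 0 \<kappa>]
      potR_shift[of A \<kappa> "- 1" "jac.first_order (fieldd \<alpha>) (\<lambda>p. 0) f" p] l
    by (simp add: jac.holo_sc[OF f p] linear_diff[OF jac.holo_linear[OF f p]] linear_neg[OF jac.holo_linear[OF f p]]
        jac.first_order_def[of _ _ f] flip: l_def) (simp add: field_simps)
qed

lemma commutator_dL:
  "jac.first_order (fieldd \<alpha>) (\<lambda>p. 0) (jac.first_order fieldL (potL \<epsilon>) f) p
    - jac.first_order fieldL (potL \<epsilon>) (jac.first_order (fieldd \<alpha>) (\<lambda>p. 0) f) p = 0"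
proof -
  have "fieldL' p (fieldd \<alpha> p) - (0, (tauC (fieldL p) - wC (fieldL p)) *s axis \<alpha> 1, 0, 0) = 0"
    by (simp add: fieldL'_def fieldd_def fieldL_def zero_prod_def vec_eq_iff power2_eq_square algebra_simps)
  moreover have "\<epsilon> * (tauC (fieldd \<alpha> p) - wC (fieldd \<alpha> p)) - 0 = 0"
    by (simp add: fieldd_def)
  ultimately show ?thesis
    unfolding jac.first_order_commutator[OF f open_cdomain p fieldd_deriv has_derivative_const fieldL_deriv potL_deriv]
    by (simp add: linear_0[OF jac.holo_linear[OF f p]])
qed

lemma commutator_DR:
  "jac.first_order (fieldD \<alpha>) (potD A \<alpha>) (jac.first_order fieldR (potR A \<kappa>) f) p
    - jac.first_order fieldR (potR A (\<kappa> + 1)) (jac.first_order (fieldD \<alpha>) (potD A \<alpha>) f) p = 0"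
proof -
  define l where "l = tauC p - wC p"
  have l: "l \<noteq> 0" using diff_nonzero by (simp add: l_def)
  have "fieldR' p (fieldD \<alpha> p) - 0 = cscale (1 / l) (fieldD \<alpha> p)"
    unfolding fieldR'_def fieldD_def cscale_def l_def[symmetric] by (simp add: vec_eq_iff)
  moreover have "potR' A \<kappa> p (fieldD \<alpha> p) - potD' A \<alpha> p (fieldR p) = potD A \<alpha> p / l"
    unfolding potR'_def fieldD_def potD_def potD'_def fieldR_def l_def[symmetric] bform_commute[OF A, of "axis \<alpha> 1"]
    using l by (simp add: bform_simps power2_eq_square field_simps)
  ultimately show ?thesis
    using jac.first_order_commutator[OF f open_cdomain p fieldD_deriv potD_deriv[OF p] fieldR_deriv[OF p] potR_deriv[OF p A], of \<alpha> A \<alpha> \<kappa>]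
      potR_shift[of A \<kappa> 1 "jac.first_order (fieldD \<alpha>) (potD A \<alpha>) f" p] l
    by (simp add: jac.holo_sc[OF f p] jac.first_order_def[of _ _ f] flip: l_def) (simp add: field_simps)
qed

lemma commutator_DL:
  "jac.first_order (fieldD \<alpha>) (potD A \<alpha>) (jac.first_order fieldL (potL \<epsilon>) f) p
    - jac.first_order fieldL (potL \<epsilon>) (jac.first_order (fieldD \<alpha>) (potD A \<alpha>) f) p = jac.first_order (fieldd \<alpha>) (\<lambda>p. 0) f p"
proof -
  define l where "l = tauC p - wC p"
  have l: "l \<noteq> 0" using diff_nonzero by (simp add: l_def)
  have "fieldL' p (fieldD \<alpha> p) - 0 = fieldd \<alpha> p"
    by (simp add: fieldL'_def fieldD_def fieldd_def zero_prod_def)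
  moreover have "\<epsilon> * (tauC (fieldD \<alpha> p) - wC (fieldD \<alpha> p)) - potD' A \<alpha> p (fieldL p) = 0"
    unfolding fieldD_def potD'_def fieldL_def l_def[symmetric]
    using l by (simp add: bform_simps power2_eq_square field_simps)
  ultimately show ?thesis
    unfolding jac.first_order_commutator[OF f open_cdomain p fieldD_deriv potD_deriv[OF p] fieldL_deriv potL_deriv]
    by (simp add: jac.first_order_def)
qed

lemma commutator_Dd:
  "jac.first_order (fieldD \<alpha>) (potD A \<alpha>) (jac.first_order (fieldd \<beta>) (\<lambda>p. 0) f) p
    - jac.first_order (fieldd \<beta>) (\<lambda>p. 0) (jac.first_order (fieldD \<alpha>) (potD A \<alpha>) f) p = 2 * of_real pi * \<i> * of_int (A $ \<alpha> $ \<beta>) * f p"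
proof -
  define l where "l = tauC p - wC p"
  have l: "l \<noteq> 0" using diff_nonzero by (simp add: l_def)
  have "(0, (tauC (fieldD \<alpha> p) - wC (fieldD \<alpha> p)) *s axis \<beta> 1, 0, 0) - 0 = (0 :: 'n point)"
    by (simp add: fieldD_def zero_prod_def)
  moreover have "0 - potD' A \<alpha> p (fieldd \<beta> p) = 2 * of_real pi * \<i> * of_int (A $ \<alpha> $ \<beta>)"
    unfolding fieldd_def potD'_def l_def[symmetric]
    using l by (simp add: bform_simps flip: bform_axis_axis)
  ultimately show ?thesis
    unfolding jac.first_order_commutator[OF f open_cdomain p fieldD_deriv potD_deriv[OF p] fieldd_deriv has_derivative_const]
    by (simp add: linear_0[OF jac.holo_linear[OF f p]])
qed

lemma commutator_DD:
  "jac.first_order (fieldD \<alpha>) (potD A \<alpha>) (jac.first_order (fieldD \<beta>) (potD A \<beta>) f) p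
    - jac.first_order (fieldD \<beta>) (potD A \<beta>) (jac.first_order (fieldD \<alpha>) (potD A \<alpha>) f) p = 0"
proof -
  have "potD' A \<beta> p (fieldD \<alpha> p) - potD' A \<alpha> p (fieldD \<beta> p) = 0"
    unfolding fieldD_def potD'_def by (simp add: bform_commute[OF A, of "axis \<beta> 1" "axis \<alpha> 1"])
  then show ?thesis
    unfolding jac.first_order_commutator[OF f open_cdomain p fieldD_deriv potD_deriv[OF p] fieldD_deriv potD_deriv[OF p]]
    by (simp add: linear_0[OF jac.holo_linear[OF f p]])
qed

lemma commutator_dd:
  "jac.first_order (fieldd \<alpha>) (\<lambda>p. 0) (jac.first_order (fieldd \<beta>) (\<lambda>p. 0) f) p
    - jac.first_order (fieldd \<beta>) (\<lambda>p. 0) (jac.first_order (fieldd \<alpha>) (\<lambda>p. 0) f) p = 0"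
  unfolding jac.first_order_commutator[OF f open_cdomain p fieldd_deriv has_derivative_const fieldd_deriv has_derivative_const]
  by (simp add: fieldd_def linear_0[OF jac.holo_linear[OF f p]] flip: zero_prod_def)

end

section \<open>Splitting off the square root\<close>

definition inv_root :: "nat \<Rightarrow> complex \<Rightarrow> complex \<Rightarrow> complex" where
  "inv_root r \<tau> w = 1 / (\<i> * (w - \<tau>)) powr (of_nat r / 2)"

text \<open>On the cut, \<open>Ln (\<i> * u)\<close> is discontinuous, but along the vertical line through \<open>u\<close> it agrees with the
  holomorphic branch \<open>Ln (- \<i> * u) + \<i> * pi\<close>. So the derivative within the vertical line is \<open>1 / u\<close> everywhere.\<close>

lemma Ln_vertical_deriv:
  assumes "u \<noteq> 0"
  shows "((\<lambda>u. Ln (\<i> * u)) has_field_derivative 1 / u) (at u within {y. Re y = Re u})"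
proof (cases "\<i> * u \<in> \<real>\<^sub>\<le>\<^sub>0")
  case False
  have "((\<lambda>u. Ln (\<i> * u)) has_field_derivative 1 / u) (at u)"
    by (rule derivative_eq_intros refl False)+ (use assms in \<open>simp add: field_simps\<close>)
  then show ?thesis by (rule has_field_derivative_at_within)
next
  case True
  with assms have u: "Re u = 0" "Im u > 0"
    by (auto simp: complex_nonpos_Reals_iff complex_eq_iff)
  have nr: "- \<i> * u \<notin> \<real>\<^sub>\<le>\<^sub>0"
    using u by (simp add: complex_nonpos_Reals_iff)
  have "((\<lambda>u. Ln (- \<i> * u) + \<i> * of_real pi) has_field_derivative 1 / u) (at u)"
    by (rule derivative_eq_intros refl nr)+ (use assms in \<open>simp add: field_simps\<close>)
  then have "((\<lambda>u. Ln (- \<i> * u) + \<i> * of_real pi) has_field_derivative 1 / u) (at u within {y. Re y = Re u})"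
    by (rule has_field_derivative_at_within)
  then show ?thesis
  proof (rule has_field_derivative_transform_within[OF _ u(2)])
    fix y assume y: "y \<in> {y. Re y = Re u}" "dist y u < Im u"
    have "\<bar>Im y - Im u\<bar> < Im u"
      using y(2) abs_Im_le_cmod[of "y - u"] by (simp add: dist_norm)
    then have "Im y > 0" by linarith
    with y u show "Ln (- \<i> * y) + \<i> * of_real pi = Ln (\<i> * y)"
      using Ln_minus[of "- \<i> * y"] by (auto simp: complex_eq_iff)
  qed simp
qed

lemma inv_root_eq_exp: "w \<noteq> \<tau> \<Longrightarrow> inv_root r \<tau> w = exp (- (of_nat r / 2) * Ln (\<i> * (w - \<tau>)))"
  by (simp add: inv_root_def powr_def exp_minus inverse_eq_divide)

lemma exp_Ln_vertical_deriv:
  assumes "u \<noteq> 0"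
  shows "((\<lambda>u. exp (a * Ln (\<i> * u))) has_field_derivative a / u * exp (a * Ln (\<i> * u))) (at u within {y. Re y = Re u})"
  by (rule derivative_eq_intros refl Ln_vertical_deriv assms)+ simp

lemma inv_root_deriv_tau:
  assumes "\<tau> \<noteq> w"
  shows "((\<lambda>t. inv_root r t w) has_field_derivative of_nat r / 2 / (w - \<tau>) * inv_root r \<tau> w) (at \<tau> within {y. Re y = Re \<tau>})"
proof -
  let ?a = "- (of_nat r / 2) :: complex"
  have "((\<lambda>u. exp (?a * Ln (\<i> * u))) has_field_derivative ?a / (w - \<tau>) * exp (?a * Ln (\<i> * (w - \<tau>)))) (at (w - \<tau>) within (\<lambda>t. w - t) ` {y. Re y = Re \<tau>})"
    by (rule DERIV_subset[OF exp_Ln_vertical_deriv]) (use assms in auto)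
  moreover have "((\<lambda>t. w - t) has_field_derivative - 1) (at \<tau> within {y. Re y = Re \<tau>})"
    by (auto intro!: derivative_eq_intros)
  ultimately have "((\<lambda>t. exp (?a * Ln (\<i> * (w - t)))) has_field_derivative ?a / (w - \<tau>) * exp (?a * Ln (\<i> * (w - \<tau>))) * (- 1)) (at \<tau> within {y. Re y = Re \<tau>})"
    by (rule DERIV_image_chain[unfolded o_def])
  then have "((\<lambda>t. exp (?a * Ln (\<i> * (w - t)))) has_field_derivative of_nat r / 2 / (w - \<tau>) * inv_root r \<tau> w) (at \<tau> within {y. Re y = Re \<tau>})"
    using assms by (simp add: inv_root_eq_exp)
  then show ?thesis
  proof (rule has_field_derivative_transform_within)
    show "0 < dist \<tau> w" using assms by simp
    show "exp (?a * Ln (\<i> * (w - t))) = inv_root r t w" if "dist t \<tau> < dist \<tau> w" for t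
      using that by (subst inv_root_eq_exp) (auto simp: dist_commute)
  qed simp
qed

lemma inv_root_deriv_w:
  assumes "\<tau> \<noteq> w"
  shows "((\<lambda>t. inv_root r \<tau> t) has_field_derivative of_nat r / 2 / (\<tau> - w) * inv_root r \<tau> w) (at w within {y. Re y = Re w})"
proof -
  let ?a = "- (of_nat r / 2) :: complex"
  have "((\<lambda>u. exp (?a * Ln (\<i> * u))) has_field_derivative ?a / (w - \<tau>) * exp (?a * Ln (\<i> * (w - \<tau>)))) (at (w - \<tau>) within (\<lambda>t. t - \<tau>) ` {y. Re y = Re w})"
    by (rule DERIV_subset[OF exp_Ln_vertical_deriv]) (use assms in auto)
  moreover have "((\<lambda>t. t - \<tau>) has_field_derivative 1) (at w within {y. Re y = Re w})"
    by (auto intro!: derivative_eq_intros)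
  ultimately have "((\<lambda>t. exp (?a * Ln (\<i> * (t - \<tau>)))) has_field_derivative ?a / (w - \<tau>) * exp (?a * Ln (\<i> * (w - \<tau>))) * 1) (at w within {y. Re y = Re w})"
    by (rule DERIV_image_chain[unfolded o_def])
  moreover have "?a / (w - \<tau>) = of_nat r / 2 / (\<tau> - w)"
    by (metis minus_diff_eq minus_divide_divide)
  ultimately have "((\<lambda>t. exp (?a * Ln (\<i> * (t - \<tau>)))) has_field_derivative of_nat r / 2 / (\<tau> - w) * inv_root r \<tau> w) (at w within {y. Re y = Re w})"
    using assms by (simp only: mult_1_right inv_root_eq_exp[OF assms[symmetric]])
  then show ?thesis
  proof (rule has_field_derivative_transform_within)
    show "0 < dist \<tau> w" using assms by simp
    show "exp (?a * Ln (\<i> * (t - \<tau>))) = inv_root r \<tau> t" if "dist t w < dist \<tau> w" for t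
      using that by (subst inv_root_eq_exp) (auto simp: dist_commute)
  qed simp
qed

text \<open>\<open>f\<close> is the holomorphic part of the component \<open>j\<close> of \<open>g\<close>. Working with components is possible since the operators
  act on each component separately.\<close>

definition is_lift :: "nat \<Rightarrow> ('n::finite, 'm::finite) jfun \<Rightarrow> 'm \<Rightarrow> ('n point \<Rightarrow> complex) \<Rightarrow> bool" where
  "is_lift r g j f \<longleftrightarrow> (\<forall>z \<zeta> \<tau> w. (\<tau>, w) \<in> half_pairs \<longrightarrow> g z \<zeta> \<tau> w $ j = inv_root r \<tau> w * f (z, \<zeta>, \<tau>, w))"

lemma is_liftD: "is_lift r g j f \<Longrightarrow> (\<tau>, w) \<in> half_pairs \<Longrightarrow> g z \<zeta> \<tau> w $ j = inv_root r \<tau> w * f (z, \<zeta>, \<tau>, w)"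
  by (simp add: is_lift_def)

lemma scale_axis: "t *s axis \<alpha> (1::complex) = axis \<alpha> t"
  by (simp add: vec_eq_iff axis_def)

context
  fixes r :: nat and g :: "('n::finite, 'm::finite) jfun" and j :: 'm and f :: "'n point \<Rightarrow> complex"
  assumes g: "is_lift r g j f" and f: "jac.holo cdomain f"
begin

lemma lift_z:
  assumes h: "(\<tau>, w) \<in> half_pairs"
  shows "d_z \<alpha> g z \<zeta> \<tau> w $ j = inv_root r \<tau> w * Df f (z, \<zeta>, \<tau>, w) (axis \<alpha> 1, 0, 0, 0)"
proof -
  let ?e = "(axis \<alpha> 1, 0, 0, 0) :: 'n point"
  have "((\<lambda>t. f ((z, \<zeta>, \<tau>, w) + cscale t ?e)) has_field_derivative Df f ((z, \<zeta>, \<tau>, w) + cscale 0 ?e) ?e) (at 0)"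
    by (rule jac.holo_line[OF f]) (use h in \<open>auto simp: cdomain_def cscale_def\<close>)
  from DERIV_cmult[OF this, of "inv_root r \<tau> w"] show ?thesis
    by (simp add: d_z_def is_liftD[OF g h] cscale_def scale_axis DERIV_imp_deriv)
qed

lemma lift_zeta:
  assumes h: "(\<tau>, w) \<in> half_pairs"
  shows "d_zeta \<alpha> g z \<zeta> \<tau> w $ j = inv_root r \<tau> w * Df f (z, \<zeta>, \<tau>, w) (0, axis \<alpha> 1, 0, 0)"
proof -
  let ?e = "(0, axis \<alpha> 1, 0, 0) :: 'n point"
  have "((\<lambda>t. f ((z, \<zeta>, \<tau>, w) + cscale t ?e)) has_field_derivative Df f ((z, \<zeta>, \<tau>, w) + cscale 0 ?e) ?e) (at 0)"
    by (rule jac.holo_line[OF f]) (use h in \<open>auto simp: cdomain_def cscale_def\<close>)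
  from DERIV_cmult[OF this, of "inv_root r \<tau> w"] show ?thesis
    by (simp add: d_zeta_def is_liftD[OF g h] cscale_def scale_axis DERIV_imp_deriv)
qed

lemma half_pairs_near:
  assumes "(\<tau>, w) \<in> half_pairs"
  obtains e where "e > 0" "\<And>t. dist t \<tau> < e \<Longrightarrow> (t, w) \<in> half_pairs" "\<And>t. dist t w < e \<Longrightarrow> (\<tau>, t) \<in> half_pairs"
proof -
  have op: "open {t. (t, w) \<in> half_pairs}" "open {t. (\<tau>, t) \<in> half_pairs}"
    unfolding half_pairs_def by (auto intro!: open_Collect_conj open_Collect_less open_Collect_neq continuous_intros)
  obtain d where "d > 0" "\<And>t. dist t \<tau> < d \<Longrightarrow> (t, w) \<in> half_pairs"
    using op(1)[unfolded open_dist, rule_format, of \<tau>] assms by auto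
  moreover obtain e where "e > 0" "\<And>t. dist t w < e \<Longrightarrow> (\<tau>, t) \<in> half_pairs"
    using op(2)[unfolded open_dist, rule_format, of w] assms by auto
  ultimately show thesis using that[of "min d e"] by simp
qed

text \<open>Here the factor split off is differentiated too, which adds its logarithmic derivative to the potential.\<close>

lemma lift_tau:
  assumes h: "(\<tau>, w) \<in> half_pairs"
  shows "d_tau g z \<zeta> \<tau> w $ j = inv_root r \<tau> w * (Df f (z, \<zeta>, \<tau>, w) (0, 0, 1, 0) - of_nat r / 2 / (\<tau> - w) * f (z, \<zeta>, \<tau>, w))"
proof -
  let ?e = "(0, 0, 1, 0) :: 'n point"
  obtain e where e: "e > 0" "\<And>t. dist t \<tau> < e \<Longrightarrow> (t, w) \<in> half_pairs" by (rule half_pairs_near[OF h]) blast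
  have ne: "\<tau> \<noteq> w" using h by (simp add: half_pairs_def)
  have "((\<lambda>t. f ((z, \<zeta>, 0, w) + cscale t ?e)) has_field_derivative Df f ((z, \<zeta>, 0, w) + cscale \<tau> ?e) ?e) (at \<tau>)"
    by (rule jac.holo_line[OF f]) (use h in \<open>auto simp: cdomain_def cscale_def\<close>)
  then have "((\<lambda>t. f (z, \<zeta>, t, w)) has_field_derivative Df f (z, \<zeta>, \<tau>, w) ?e) (at \<tau> within {y. Re y = Re \<tau>})"
    by (simp add: cscale_def has_field_derivative_at_within)
  from DERIV_mult[OF inv_root_deriv_tau[OF ne, of r] this]
  have "((\<lambda>t. g z \<zeta> t w $ j) has_field_derivative
      (of_nat r / 2 / (w - \<tau>) * inv_root r \<tau> w * f (z, \<zeta>, \<tau>, w) + Df f (z, \<zeta>, \<tau>, w) ?e * inv_root r \<tau> w)) (at \<tau> within {y. Re y = Re \<tau>})"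
    by (rule has_field_derivative_transform_within[OF _ e(1)]) (use e(2) is_liftD[OF g] in auto)
  then have "d_tau g z \<zeta> \<tau> w $ j = of_nat r / 2 / (w - \<tau>) * inv_root r \<tau> w * f (z, \<zeta>, \<tau>, w) + Df f (z, \<zeta>, \<tau>, w) ?e * inv_root r \<tau> w"
    unfolding d_tau_def by (simp add: branch_deriv_eqI)
  moreover have "of_nat r / 2 / (w - \<tau>) = - (of_nat r / 2 / (\<tau> - w) :: complex)"
    by (metis minus_diff_eq minus_divide_right)
  ultimately show ?thesis
    by (simp only:) (simp add: algebra_simps)
qed

lemma lift_w:
  assumes h: "(\<tau>, w) \<in> half_pairs"
  shows "d_w g z \<zeta> \<tau> w $ j = inv_root r \<tau> w * (Df f (z, \<zeta>, \<tau>, w) (0, 0, 0, 1) + of_nat r / 2 / (\<tau> - w) * f (z, \<zeta>, \<tau>, w))"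
proof -
  let ?e = "(0, 0, 0, 1) :: 'n point"
  obtain e where e: "e > 0" "\<And>t. dist t w < e \<Longrightarrow> (\<tau>, t) \<in> half_pairs" by (rule half_pairs_near[OF h]) blast
  have ne: "\<tau> \<noteq> w" using h by (simp add: half_pairs_def)
  have "((\<lambda>t. f ((z, \<zeta>, \<tau>, 0) + cscale t ?e)) has_field_derivative Df f ((z, \<zeta>, \<tau>, 0) + cscale w ?e) ?e) (at w)"
    by (rule jac.holo_line[OF f]) (use h in \<open>auto simp: cdomain_def cscale_def\<close>)
  then have "((\<lambda>t. f (z, \<zeta>, \<tau>, t)) has_field_derivative Df f (z, \<zeta>, \<tau>, w) ?e) (at w within {y. Re y = Re w})"
    by (simp add: cscale_def has_field_derivative_at_within)
  from DERIV_mult[OF inv_root_deriv_w[OF ne, of r] this]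
  have "((\<lambda>t. g z \<zeta> \<tau> t $ j) has_field_derivative
      (of_nat r / 2 / (\<tau> - w) * inv_root r \<tau> w * f (z, \<zeta>, \<tau>, w) + Df f (z, \<zeta>, \<tau>, w) ?e * inv_root r \<tau> w)) (at w within {y. Re y = Re w})"
    by (rule has_field_derivative_transform_within[OF _ e(1)]) (use e(2) is_liftD[OF g] in auto)
  then have "d_w g z \<zeta> \<tau> w $ j = of_nat r / 2 / (\<tau> - w) * inv_root r \<tau> w * f (z, \<zeta>, \<tau>, w) + Df f (z, \<zeta>, \<tau>, w) ?e * inv_root r \<tau> w"
    unfolding d_w_def by (simp add: branch_deriv_eqI)
  then show ?thesis
    by (simp add: algebra_simps)
qed

text \<open>Complex linearity of the derivative turns the coordinate expressions that define the operators into derivatives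
  along vector fields.\<close>

lemma Df_coordinates:
  assumes p: "p \<in> cdomain"
  shows "Df f p (x, y, s, t) = (\<Sum>\<alpha>\<in>UNIV. x $ \<alpha> * Df f p (axis \<alpha> 1, 0, 0, 0))
    + (\<Sum>\<alpha>\<in>UNIV. y $ \<alpha> * Df f p (0, axis \<alpha> 1, 0, 0)) + s * Df f p (0, 0, 1, 0) + t * Df f p (0, 0, 0, 1)"
proof -
  note lin = jac.holo_linear[OF f p]
  have v: "v = (\<Sum>\<alpha>\<in>UNIV. v $ \<alpha> *s axis \<alpha> 1)" for v :: "complex ^ 'n"
    by (simp add: basis_expansion)
  have "(x, y, s, t) = (\<Sum>\<alpha>\<in>UNIV. cscale (x $ \<alpha>) (axis \<alpha> 1, 0, 0, 0)) + (\<Sum>\<alpha>\<in>UNIV. cscale (y $ \<alpha>) (0, axis \<alpha> 1, 0, 0))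
     + cscale s (0, 0, 1, 0) + cscale t (0, 0, 0, 1)"
    by (simp add: cscale_def prod_eq_iff fst_sum snd_sum flip: v)
  then show ?thesis
    by (simp only: linear_add[OF lin] linear_sum[OF lin] jac.holo_sc[OF f p])
qed

lemma is_lift_R: "is_lift r (opR A k g) j (jac.first_order fieldR (potR A (of_real k - of_nat r / 2)) f)"
  unfolding is_lift_def
proof (intro allI impI)
  fix z \<zeta> :: "complex ^ 'n" and \<tau> w assume h: "(\<tau>, w) \<in> half_pairs"
  let ?p = "(z, \<zeta>, \<tau>, w)"
  have p: "?p \<in> cdomain" using h by (simp add: cdomain_def)
  define q where "q = 2 * of_real pi * \<i> * qform A ((1 / (\<tau> - w)) *s (z - \<zeta>))"
  define X where "X = (\<Sum>\<alpha>\<in>UNIV. (z $ \<alpha> - \<zeta> $ \<alpha>) / (\<tau> - w) * Df f ?p (axis \<alpha> 1, 0, 0, 0))"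
  have sum: "(\<Sum>\<alpha>\<in>UNIV. ((z $ \<alpha> - \<zeta> $ \<alpha>) / (\<tau> - w)) *s d_z \<alpha> g z \<zeta> \<tau> w) $ j = inv_root r \<tau> w * X"
    unfolding X_def sum_component vector_smult_component lift_z[OF h] sum_distrib_left
    by (rule sum.cong) (simp_all add: mult.left_commute)
  have "Df f ?p (fieldR ?p) = X + Df f ?p (0, 0, 1, 0)"
    unfolding fieldR_def X_def by (subst Df_coordinates[OF p]) (simp add: algebra_simps diff_divide_distrib)
  moreover have "potR A (of_real k - of_nat r / 2) ?p = q + of_real k / (\<tau> - w) - of_nat r / 2 / (\<tau> - w)"
    unfolding potR_def q_def fst_conv snd_conv diff_divide_distrib by (simp only: add_diff_eq)
  ultimately have "jac.first_order fieldR (potR A (of_real k - of_nat r / 2)) f ?p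
      = X + Df f ?p (0, 0, 1, 0) + (q + of_real k / (\<tau> - w) - of_nat r / 2 / (\<tau> - w)) * f ?p"
    by (simp only: jac.first_order_def)
  moreover have "opR A k g z \<zeta> \<tau> w $ j = inv_root r \<tau> w * (Df f ?p (0, 0, 1, 0) - of_nat r / 2 / (\<tau> - w) * f ?p)
      + inv_root r \<tau> w * X + q * (inv_root r \<tau> w * f ?p) + of_real k / (\<tau> - w) * (inv_root r \<tau> w * f ?p)"
    unfolding opR_def vector_add_component sum vector_smult_component lift_tau[OF h] is_liftD[OF g h] q_def ..
  ultimately show "opR A k g z \<zeta> \<tau> w $ j = inv_root r \<tau> w * jac.first_order fieldR (potR A (of_real k - of_nat r / 2)) f ?p"
    by (simp only: ring_distribs mult_ac add_ac diff_conv_add_uminus mult_minus_left mult_minus_right)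
qed

lemma is_lift_L: "is_lift r (opL g) j (jac.first_order fieldL (potL (of_nat r / 2)) f)"
  unfolding is_lift_def
proof (intro allI impI)
  fix z \<zeta> :: "complex ^ 'n" and \<tau> w assume h: "(\<tau>, w) \<in> half_pairs"
  let ?p = "(z, \<zeta>, \<tau>, w)"
  have p: "?p \<in> cdomain" using h by (simp add: cdomain_def)
  define X where "X = (\<Sum>\<alpha>\<in>UNIV. (z $ \<alpha> - \<zeta> $ \<alpha>) * Df f ?p (0, axis \<alpha> 1, 0, 0))"
  define l where "l = \<tau> - w"
  have l: "l \<noteq> 0" using h by (simp add: l_def half_pairs_def)
  have sum: "(\<Sum>\<alpha>\<in>UNIV. (z $ \<alpha> - \<zeta> $ \<alpha>) *s d_zeta \<alpha> g z \<zeta> \<tau> w) $ j = inv_root r \<tau> w * X"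
    unfolding X_def sum_component vector_smult_component lift_zeta[OF h] sum_distrib_left
    by (rule sum.cong) (simp_all add: mult.left_commute)
  have "Df f ?p (fieldL ?p) = l * X + l\<^sup>2 * Df f ?p (0, 0, 0, 1)"
    unfolding fieldL_def X_def sum_distrib_left by (subst Df_coordinates[OF p]) (simp add: algebra_simps flip: l_def)
  then have "jac.first_order fieldL (potL (of_nat r / 2)) f ?p = l * X + l\<^sup>2 * Df f ?p (0, 0, 0, 1) + of_nat r / 2 * l * f ?p"
    by (simp add: jac.first_order_def potL_def flip: l_def)
  moreover have "opL g z \<zeta> \<tau> w $ j = l * (l * (inv_root r \<tau> w * (Df f ?p (0, 0, 0, 1) + of_nat r / 2 / l * f ?p)) + inv_root r \<tau> w * X)"
    unfolding opL_def vector_add_component sum vector_smult_component lift_w[OF h] l_def ..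
  ultimately show "opL g z \<zeta> \<tau> w $ j = inv_root r \<tau> w * jac.first_order fieldL (potL (of_nat r / 2)) f ?p"
    by (simp only:) (use l in \<open>simp add: field_simps power2_eq_square\<close>)
qed

lemma is_lift_D: "is_lift r (opD A \<alpha> g) j (jac.first_order (fieldD \<alpha>) (potD A \<alpha>) f)"
  unfolding is_lift_def jac.first_order_def fieldD_def potD_def opD_def bform_axis
  by (simp add: lift_z is_liftD[OF g] algebra_simps)

lemma is_lift_d: "is_lift r (opd \<alpha> g) j (jac.first_order (fieldd \<alpha>) (\<lambda>p. 0) f)"
  unfolding is_lift_def
proof (intro allI impI)
  fix z \<zeta> :: "complex ^ 'n" and \<tau> w assume h: "(\<tau>, w) \<in> half_pairs"
  let ?p = "(z, \<zeta>, \<tau>, w)"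
  have p: "?p \<in> cdomain" using h by (simp add: cdomain_def)
  have "fieldd \<alpha> ?p = cscale (\<tau> - w) (0, axis \<alpha> 1, 0, 0)"
    by (simp add: fieldd_def cscale_def)
  then show "opd \<alpha> g z \<zeta> \<tau> w $ j = inv_root r \<tau> w * jac.first_order (fieldd \<alpha>) (\<lambda>p. 0) f ?p"
    by (simp only: jac.first_order_def opd_def vector_smult_component lift_zeta[OF h] jac.holo_sc[OF f p])
      (simp only: mult_zero_left add_0_right mult.left_commute)
qed

end

lemma admissible_is_lift:
  assumes "admissible r (g :: ('n::finite, 'm::finite) jfun)"
  obtains f where "\<And>j. jac.holo cdomain (f j)" "\<And>j. is_lift r g j (f j)"
proof
  define f where "f j = (\<lambda>(z, \<zeta>, \<tau>, w). ((\<i> * (w - \<tau>)) powr (of_nat r / 2)) * g z \<zeta> \<tau> w $ j)" for j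
  show "jac.holo cdomain (f j)" for j
    unfolding jac.holo_def
  proof
    fix p :: "'n point" assume "p \<in> cdomain"
    obtain z \<zeta> \<tau> w where p: "p = (z, \<zeta>, \<tau>, w)" "(\<tau>, w) \<in> half_pairs" using \<open>p \<in> cdomain\<close> by (auto simp: cdomain_def)
    obtain F where F: "((\<lambda>(z, \<zeta>, \<tau>, w). ((\<i> * (w - \<tau>)) powr (of_nat r / 2)) *s g z \<zeta> \<tau> w) has_derivative F) (at p)"
        "\<And>c x y s t. F (c *s x, c *s y, c * s, c * t) = c *s F (x, y, s, t)"
      using assms[unfolded admissible_def holomorphic_jfun_def, rule_format, OF p(2), of z \<zeta>] p(1) by blast
    have "(f j has_derivative (\<lambda>u. F u $ j)) (at p)"
      using bounded_linear.has_derivative[OF bounded_linear_vec_nth F(1), of j]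
      by (simp add: f_def case_prod_unfold)
    moreover have "F (cscale c u) $ j = c * F u $ j" for c u
      using F(2) by (cases u) (simp add: cscale_def)
    ultimately show "\<exists>F. (f j has_derivative F) (at p) \<and> (\<forall>c v. F (cscale c v) = c * F v)"
      by blast
  qed
  show "is_lift r g j (f j)" for j
    by (auto simp: is_lift_def f_def inv_root_def half_pairs_def)
qed

section \<open>The action of the modular group on the upper half-plane\<close>

lemma autf_diff: "autf \<gamma> \<tau> - autf \<gamma> w = of_int (\<gamma> $ 2 $ 1) * (\<tau> - w)"
  by (simp add: autf_def algebra_simps)

lemma SL2Z_det: "\<gamma> \<in> SL2Z \<Longrightarrow> of_int (\<gamma> $ 1 $ 1) * of_int (\<gamma> $ 2 $ 2) - of_int (\<gamma> $ 1 $ 2) * of_int (\<gamma> $ 2 $ 1) = (1 :: complex)"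
  unfolding SL2Z_def det_2 by (simp flip: of_int_mult of_int_diff)

lemma autf_nonzero:
  assumes "\<gamma> \<in> SL2Z" "Im \<tau> > 0" shows "autf \<gamma> \<tau> \<noteq> 0"
proof
  assume "autf \<gamma> \<tau> = 0"
  then have "of_int (\<gamma> $ 2 $ 1) * Im \<tau> = 0" "of_int (\<gamma> $ 2 $ 1) * Re \<tau> + of_int (\<gamma> $ 2 $ 2) = 0"
    by (simp_all add: autf_def complex_eq_iff)
  with assms(2) have "\<gamma> $ 2 $ 1 = 0" "\<gamma> $ 2 $ 2 = 0" by auto
  with SL2Z_det[OF assms(1)] show False by simp
qed

lemma autf_not_nonpos:
  assumes "\<gamma> $ 2 $ 1 \<noteq> 0" "Im \<tau> > 0" shows "autf \<gamma> \<tau> \<notin> \<real>\<^sub>\<le>\<^sub>0"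
  using assms by (simp add: autf_def complex_nonpos_Reals_iff)

lemma moeb_diff:
  assumes "\<gamma> \<in> SL2Z" "autf \<gamma> \<tau> \<noteq> 0" "autf \<gamma> w \<noteq> 0"
  shows "moeb \<gamma> \<tau> - moeb \<gamma> w = (\<tau> - w) / (autf \<gamma> \<tau> * autf \<gamma> w)"
proof -
  let ?a = "of_int (\<gamma> $ 1 $ 1) :: complex" and ?b = "of_int (\<gamma> $ 1 $ 2) :: complex"
    and ?c = "of_int (\<gamma> $ 2 $ 1) :: complex" and ?d = "of_int (\<gamma> $ 2 $ 2) :: complex"
  have "(?a * \<tau> + ?b) * autf \<gamma> w - (?a * w + ?b) * autf \<gamma> \<tau> = (?a * ?d - ?b * ?c) * (\<tau> - w)"
    by (simp add: autf_def algebra_simps)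
  then have "(?a * \<tau> + ?b) * autf \<gamma> w - (?a * w + ?b) * autf \<gamma> \<tau> = \<tau> - w"
    by (simp add: SL2Z_det[OF assms(1)])
  then show ?thesis
    using assms(2,3) by (simp add: moeb_def diff_frac_eq)
qed

text \<open>Taking \<open>w\<close> to be the complex conjugate of \<open>\<tau>\<close> in \<open>moeb_diff\<close> gives the familiar formula for the
  imaginary part of a Moebius transform.\<close>

lemma moeb_half_pairs:
  assumes \<gamma>: "\<gamma> \<in> SL2Z" and h: "(\<tau>, w) \<in> half_pairs"
  shows "(moeb \<gamma> \<tau>, moeb \<gamma> w) \<in> half_pairs"
proof -
  have Im: "Im (moeb \<gamma> t) > 0" if t: "Im t > 0" for t
  proof -
    have c: "autf \<gamma> (cnj t) = cnj (autf \<gamma> t)" "moeb \<gamma> (cnj t) = cnj (moeb \<gamma> t)"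
      by (simp_all add: autf_def moeb_def)
    have "moeb \<gamma> t - cnj (moeb \<gamma> t) = (t - cnj t) / (autf \<gamma> t * cnj (autf \<gamma> t))"
      using moeb_diff[OF \<gamma>, of t "cnj t"] autf_nonzero[OF \<gamma> t] by (simp add: c)
    then have "2 * \<i> * of_real (Im (moeb \<gamma> t)) = 2 * \<i> * of_real (Im t) / of_real ((norm (autf \<gamma> t))\<^sup>2)"
      by (simp add: complex_diff_cnj complex_mult_cnj cmod_power2 mult_ac)
    then have "of_real (Im (moeb \<gamma> t)) = (of_real (Im t / (norm (autf \<gamma> t))\<^sup>2) :: complex)"
      unfolding times_divide_eq_right[symmetric] mult_cancel_left by simp
    then have "Im (moeb \<gamma> t) = Im t / (norm (autf \<gamma> t))\<^sup>2"
      by (simp only: of_real_eq_iff)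
    then show ?thesis using t autf_nonzero[OF \<gamma> t] by simp
  qed
  have "moeb \<gamma> \<tau> \<noteq> moeb \<gamma> w"
    using moeb_diff[OF \<gamma>, of \<tau> w] autf_nonzero[OF \<gamma>] h by (auto simp: half_pairs_def)
  then show ?thesis using h Im by (simp add: half_pairs_def)
qed

text \<open>A product of many factors is best differentiated logarithmically: the logarithmic derivatives \<open>L\<close> add up.
  This form also makes sense where \<open>F\<close> vanishes.\<close>

definition has_logder :: "('a::real_normed_vector \<Rightarrow> complex) \<Rightarrow> ('a \<Rightarrow> complex) \<Rightarrow> 'a \<Rightarrow> bool" where
  "has_logder F L p \<longleftrightarrow> (F has_derivative (\<lambda>u. F p * L u)) (at p)"

lemma has_logder_mult:
  assumes "has_logder F L p" "has_logder G M p"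
  shows "has_logder (\<lambda>q. F q * G q) (\<lambda>u. L u + M u) p"
  using has_derivative_mult[OF assms[unfolded has_logder_def]]
  unfolding has_logder_def by (rule has_derivative_eq_rhs) (simp add: algebra_simps)

lemma has_logder_power:
  assumes "has_logder F L p"
  shows "has_logder (\<lambda>q. F q ^ n) (\<lambda>u. of_nat n * L u) p"
proof (induction n)
  case 0 then show ?case by (simp add: has_logder_def)
next
  case (Suc n)
  from has_logder_mult[OF assms Suc] show ?case by (simp add: distrib_right)
qed

lemma has_logder_exp:
  assumes "(E has_derivative E') (at p)" shows "has_logder (\<lambda>q. exp (E q)) E' p"
proof -
  have "((\<lambda>q. exp (E q)) has_derivative (\<lambda>u. exp (E p) * E' u)) (at p)"
    by (rule has_derivative_compose[OF assms]) (use DERIV_exp in \<open>simp add: has_field_derivative_def\<close>)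
  then show ?thesis by (simp add: has_logder_def)
qed

lemma has_logder_compose:
  assumes "(F has_field_derivative D * F (h p)) (at (h p))" "(h has_derivative h') (at p)"
  shows "has_logder (\<lambda>q. F (h q)) (\<lambda>u. D * h' u) p"
  using has_derivative_compose[OF assms(2) assms(1)[unfolded has_field_derivative_def]]
  by (simp add: has_logder_def mult_ac)

lemma autf_deriv: "(autf \<gamma> has_field_derivative of_int (\<gamma> $ 2 $ 1)) (at t)"
  unfolding autf_def[abs_def] by (auto intro!: derivative_eq_intros)

text \<open>For \<open>c = 0\<close> the automorphy factor may be the constant \<open>-1\<close>, which lies on the branch cut of the power; the
  function is constant then. For \<open>c \<noteq> 0\<close> the factor is never real.\<close>

lemma autf_powr_deriv:
  assumes "\<gamma> \<in> SL2Z" "Im \<tau> > 0"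
  shows "((\<lambda>t. autf \<gamma> t powr a) has_field_derivative (a * of_int (\<gamma> $ 2 $ 1) / autf \<gamma> \<tau>) * autf \<gamma> \<tau> powr a) (at \<tau>)"
proof (cases "\<gamma> $ 2 $ 1 = 0")
  case True
  then show ?thesis by (simp add: autf_def)
next
  case False
  have "((\<lambda>t. autf \<gamma> t powr a) has_field_derivative (a * autf \<gamma> \<tau> powr (a - 1)) * of_int (\<gamma> $ 2 $ 1)) (at \<tau>)"
    by (rule DERIV_chain2[OF has_field_derivative_powr autf_deriv]) (rule autf_not_nonpos[OF False assms(2)])
  then show ?thesis
    using autf_nonzero[OF assms] by (simp add: powr_diff mult_ac)
qed

lemma csqrt_autf_deriv:
  assumes "\<gamma> \<in> SL2Z" "Im \<tau> > 0"
  shows "((\<lambda>t. csqrt (autf \<gamma> t)) has_field_derivative (of_int (\<gamma> $ 2 $ 1) / (2 * autf \<gamma> \<tau>)) * csqrt (autf \<gamma> \<tau>)) (at \<tau>)"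
proof (cases "\<gamma> $ 2 $ 1 = 0")
  case True
  then show ?thesis by (simp add: autf_def del: csqrt.simps)
next
  case False
  have n: "csqrt (autf \<gamma> \<tau>) \<noteq> 0" using autf_nonzero[OF assms] by (simp del: csqrt.simps)
  have "autf \<gamma> \<tau> = csqrt (autf \<gamma> \<tau>) * csqrt (autf \<gamma> \<tau>)"
    by (metis power2_csqrt power2_eq_square)
  then have "inverse (2 * csqrt (autf \<gamma> \<tau>)) * of_int (\<gamma> $ 2 $ 1) = of_int (\<gamma> $ 2 $ 1) / (2 * autf \<gamma> \<tau>) * csqrt (autf \<gamma> \<tau>)"
    using n by (simp add: field_simps del: csqrt.simps)
  then show ?thesis
    using DERIV_chain2[OF has_field_derivative_csqrt[OF autf_not_nonpos[OF False assms(2)]] autf_deriv] by (simp only:)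
qed

section \<open>The action of the Jacobi group\<close>

definition shifted :: "int ^ 'n \<Rightarrow> int ^ 'n \<Rightarrow> complex ^ ('n::finite) \<Rightarrow> complex \<Rightarrow> complex ^ 'n" where
  "shifted \<mu> \<nu> z \<tau> = z + \<tau> *s cvec \<mu> + cvec \<nu>"

definition jact :: "int ^ 2 ^ 2 \<Rightarrow> int ^ 'n \<Rightarrow> int ^ 'n \<Rightarrow> ('n::finite) point \<Rightarrow> 'n point" where
  "jact \<gamma> \<mu> \<nu> p = ((1 / autf \<gamma> (tauC p)) *s shifted \<mu> \<nu> (zC p) (tauC p), (1 / autf \<gamma> (wC p)) *s shifted \<mu> \<nu> (zetaC p) (wC p),
     moeb \<gamma> (tauC p), moeb \<gamma> (wC p))"

text \<open>The derivative of \<open>jact\<close> at \<open>p\<close>; the entries \<open>tauC u / j\<^sup>2\<close> use that the determinant is 1.\<close>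

definition jact' :: "int ^ 2 ^ 2 \<Rightarrow> int ^ 'n \<Rightarrow> int ^ 'n \<Rightarrow> ('n::finite) point \<Rightarrow> 'n point \<Rightarrow> 'n point" where
  "jact' \<gamma> \<mu> \<nu> p u =
    ((1 / autf \<gamma> (tauC p)) *s (zC u + tauC u *s cvec \<mu>) - (of_int (\<gamma> $ 2 $ 1) * tauC u / (autf \<gamma> (tauC p))\<^sup>2) *s shifted \<mu> \<nu> (zC p) (tauC p),
     (1 / autf \<gamma> (wC p)) *s (zetaC u + wC u *s cvec \<mu>) - (of_int (\<gamma> $ 2 $ 1) * wC u / (autf \<gamma> (wC p))\<^sup>2) *s shifted \<mu> \<nu> (zetaC p) (wC p),
     tauC u / (autf \<gamma> (tauC p))\<^sup>2, wC u / (autf \<gamma> (wC p))\<^sup>2)"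

definition jexponent :: "int ^ 'n ^ 'n \<Rightarrow> int ^ 2 ^ 2 \<Rightarrow> int ^ 'n \<Rightarrow> int ^ 'n \<Rightarrow> ('n::finite) point \<Rightarrow> complex" where
  "jexponent A \<gamma> \<mu> \<nu> p = - (of_int (\<gamma> $ 2 $ 1) * qform A (shifted \<mu> \<nu> (zC p) (tauC p))) / autf \<gamma> (tauC p)
     + qform A (cvec \<mu>) * tauC p + bform A (cvec \<mu>) (zC p) + qform A (cvec \<mu> + cvec \<nu>)"

definition jexponent' :: "int ^ 'n ^ 'n \<Rightarrow> int ^ 2 ^ 2 \<Rightarrow> int ^ 'n \<Rightarrow> int ^ 'n \<Rightarrow> ('n::finite) point \<Rightarrow> 'n point \<Rightarrow> complex" where
  "jexponent' A \<gamma> \<mu> \<nu> p u = - of_int (\<gamma> $ 2 $ 1) * (bform A (shifted \<mu> \<nu> (zC p) (tauC p)) (zC u + tauC u *s cvec \<mu>) / autf \<gamma> (tauC p)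
       - qform A (shifted \<mu> \<nu> (zC p) (tauC p)) * (of_int (\<gamma> $ 2 $ 1) * tauC u) / (autf \<gamma> (tauC p))\<^sup>2)
     + qform A (cvec \<mu>) * tauC u + bform A (cvec \<mu>) (zC u)"

text \<open>The factor of the slash operation after \<open>\<chi> ^ r\<close> and the power of \<open>\<i>(w - \<tau>)\<close> at the image point have been
  combined. Unlike \<open>\<chi>\<close> it is holomorphic.\<close>

definition jfactor :: "int ^ 'n ^ 'n \<Rightarrow> nat \<Rightarrow> complex \<Rightarrow> int ^ 2 ^ 2 \<Rightarrow> int ^ 'n \<Rightarrow> int ^ 'n \<Rightarrow> ('n::finite) point \<Rightarrow> complex" where
  "jfactor A r \<kappa> \<gamma> \<mu> \<nu> p = autf \<gamma> (tauC p) powr (- \<kappa>) * csqrt (autf \<gamma> (tauC p)) ^ r * csqrt (autf \<gamma> (wC p)) ^ r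
     * exp (2 * of_real pi * \<i> * jexponent A \<gamma> \<mu> \<nu> p)"

text \<open>The derivative of \<open>log jfactor\<close> at \<open>p\<close> in direction \<open>u\<close>.\<close>

definition jfactor_logder :: "int ^ 'n ^ 'n \<Rightarrow> nat \<Rightarrow> complex \<Rightarrow> int ^ 2 ^ 2 \<Rightarrow> int ^ 'n \<Rightarrow> int ^ 'n \<Rightarrow> ('n::finite) point \<Rightarrow> 'n point \<Rightarrow> complex" where
  "jfactor_logder A r \<kappa> \<gamma> \<mu> \<nu> p u = - (\<kappa> - of_nat r / 2) * of_int (\<gamma> $ 2 $ 1) * tauC u / autf \<gamma> (tauC p)
     + of_nat r / 2 * of_int (\<gamma> $ 2 $ 1) * wC u / autf \<gamma> (wC p) + 2 * of_real pi * \<i> * jexponent' A \<gamma> \<mu> \<nu> p u"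

lemma has_derivative_autf_inverse:
  assumes "(h has_derivative h') (at p)" "autf \<gamma> (h p) \<noteq> 0"
  shows "((\<lambda>q. 1 / autf \<gamma> (h q)) has_derivative (\<lambda>u. - (of_int (\<gamma> $ 2 $ 1) * h' u / (autf \<gamma> (h p))\<^sup>2))) (at p)"
proof -
  have "((\<lambda>t. 1 / autf \<gamma> t) has_field_derivative - (of_int (\<gamma> $ 2 $ 1) / (autf \<gamma> (h p))\<^sup>2)) (at (h p))"
    using assms(2) by (auto intro!: derivative_eq_intros autf_deriv simp: power2_eq_square)
  from has_derivative_compose[OF assms(1) this[unfolded has_field_derivative_def]] show ?thesis
    by simp
qed

lemma has_derivative_moeb:
  assumes \<gamma>: "\<gamma> \<in> SL2Z" and h: "(h has_derivative h') (at p)" and n: "autf \<gamma> (h p) \<noteq> 0"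
  shows "((\<lambda>q. moeb \<gamma> (h q)) has_derivative (\<lambda>u. h' u / (autf \<gamma> (h p))\<^sup>2)) (at p)"
proof -
  let ?a = "of_int (\<gamma> $ 1 $ 1) :: complex" and ?b = "of_int (\<gamma> $ 1 $ 2) :: complex"
    and ?c = "of_int (\<gamma> $ 2 $ 1) :: complex" and ?d = "of_int (\<gamma> $ 2 $ 2) :: complex"
  have "?a * autf \<gamma> (h p) - (?a * h p + ?b) * ?c = ?a * ?d - ?b * ?c"
    by (simp add: autf_def algebra_simps)
  then have det: "?a * autf \<gamma> (h p) - (?a * h p + ?b) * ?c = 1"
    by (simp add: SL2Z_det[OF \<gamma>])
  have "((\<lambda>t. ?a * t + ?b) has_field_derivative ?a) (at (h p))"
    by (auto intro!: derivative_eq_intros)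
  from DERIV_divide[OF this autf_deriv n]
  have "(moeb \<gamma> has_field_derivative 1 / (autf \<gamma> (h p))\<^sup>2) (at (h p))"
    unfolding det moeb_def[abs_def] power2_eq_square .
  from has_derivative_compose[OF h this[unfolded has_field_derivative_def]] show ?thesis
    by simp
qed

context
  fixes A :: "int ^ ('n::finite) ^ 'n" and \<gamma> :: "int ^ 2 ^ 2" and \<mu> \<nu> :: "int ^ 'n" and p :: "'n point" and r :: nat
  assumes A: "transpose A = A" and \<gamma>: "\<gamma> \<in> SL2Z" and p: "p \<in> cdomain"
begin

lemma autf_tau: "autf \<gamma> (tauC p) \<noteq> 0" and autf_w: "autf \<gamma> (wC p) \<noteq> 0"
  using p by (auto simp: cdomain_iff intro!: autf_nonzero[OF \<gamma>])

lemma jact_cdomain: "jact \<gamma> \<mu> \<nu> p \<in> cdomain"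
  using p moeb_half_pairs[OF \<gamma>, of "tauC p" "wC p"] by (simp add: cdomain_iff jact_def half_pairs_def case_prod_beta)

lemma jact_deriv: "(jact \<gamma> \<mu> \<nu> has_derivative jact' \<gamma> \<mu> \<nu> p) (at p)"
  unfolding jact_def[abs_def] shifted_def
  by (rule has_derivative_eq_rhs, (rule has_derivative_moeb[OF \<gamma>] has_derivative_autf_inverse derivative_intros autf_tau autf_w)+)
    (simp add: jact'_def shifted_def fun_eq_iff vec_eq_iff)

lemma jexponent_deriv: "(jexponent A \<gamma> \<mu> \<nu> has_derivative jexponent' A \<gamma> \<mu> \<nu> p) (at p)"
proof -
  let ?Z = "\<lambda>p. shifted \<mu> \<nu> (zC p) (tauC p)" and ?Z' = "\<lambda>u. zC u + tauC u *s cvec \<mu>"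
  let ?j = "autf \<gamma> (tauC p)" and ?c = "of_int (\<gamma> $ 2 $ 1)"
  have Z: "(?Z has_derivative ?Z') (at p)"
    unfolding shifted_def by (rule has_derivative_eq_rhs, (rule derivative_intros)+) simp
  have Q: "((\<lambda>p. qform A (?Z p)) has_derivative (\<lambda>u. bform A (?Z p) (?Z' u))) (at p)"
    unfolding qform_def
    by (rule has_derivative_eq_rhs[OF bounded_linear.has_derivative[OF bounded_linear_divide has_derivative_bform[OF Z Z]]])
      (simp add: bform_commute[OF A, of "?Z' _"])
  have "((\<lambda>p. 1 / autf \<gamma> (tauC p)) has_derivative (\<lambda>u. - (?c * tauC u / ?j\<^sup>2))) (at p)"
    by (rule has_derivative_autf_inverse[where h = "\<lambda>p. tauC p"]) (rule derivative_intros autf_tau)+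
  from has_derivative_mult[OF Q this]
  have "((\<lambda>p. - ?c * (qform A (?Z p) * (1 / autf \<gamma> (tauC p))) + qform A (cvec \<mu>) * tauC p + bform A (cvec \<mu>) (zC p) + qform A (cvec \<mu> + cvec \<nu>))
    has_derivative (\<lambda>u. - ?c * (qform A (?Z p) * - (?c * tauC u / ?j\<^sup>2) + bform A (?Z p) (?Z' u) * (1 / ?j)) + qform A (cvec \<mu>) * tauC u
      + (bform A (cvec \<mu>) (zC u) + bform A 0 (zC p)) + 0)) (at p)"
    by (intro has_derivative_add has_derivative_mult_right has_derivative_bform has_derivative_const has_derivative_fst has_derivative_snd has_derivative_ident)
  then show ?thesis
    unfolding jexponent_def[abs_def] jexponent'_def[abs_def] by (simp add: bform_zero_left algebra_simps)
qed

lemma jfactor_deriv: "(jfactor A r \<kappa> \<gamma> \<mu> \<nu> has_derivative (\<lambda>u. jfactor A r \<kappa> \<gamma> \<mu> \<nu> p * jfactor_logder A r \<kappa> \<gamma> \<mu> \<nu> p u)) (at p)"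
proof -
  have t: "(tauC has_derivative tauC) (at p)" and w: "(wC has_derivative wC) (at p)"
    by (rule derivative_intros)+
  have Im: "Im (tauC p) > 0" "Im (wC p) > 0" using p by (simp_all add: cdomain_iff)
  let ?c = "of_int (\<gamma> $ 2 $ 1)"
  have "has_logder (jfactor A r \<kappa> \<gamma> \<mu> \<nu>) (\<lambda>u. - \<kappa> * ?c / autf \<gamma> (tauC p) * tauC u
      + of_nat r * (?c / (2 * autf \<gamma> (tauC p)) * tauC u) + of_nat r * (?c / (2 * autf \<gamma> (wC p)) * wC u)
      + 2 * of_real pi * \<i> * jexponent' A \<gamma> \<mu> \<nu> p u) p"
    unfolding jfactor_def[abs_def]
    by (intro has_logder_mult has_logder_power has_logder_exp has_derivative_mult_right jexponent_deriv
        has_logder_compose[OF _ t] has_logder_compose[OF _ w] autf_powr_deriv csqrt_autf_deriv \<gamma> Im)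
  moreover have "- \<kappa> * ?c / autf \<gamma> (tauC p) * tauC u
      + of_nat r * (?c / (2 * autf \<gamma> (tauC p)) * tauC u) + of_nat r * (?c / (2 * autf \<gamma> (wC p)) * wC u)
      + 2 * of_real pi * \<i> * jexponent' A \<gamma> \<mu> \<nu> p u = jfactor_logder A r \<kappa> \<gamma> \<mu> \<nu> p u" for u
    unfolding jfactor_logder_def by (simp add: algebra_simps diff_divide_distrib)
  ultimately show ?thesis
    by (simp add: has_logder_def)
qed

lemma jact_diff: "tauC (jact \<gamma> \<mu> \<nu> p) - wC (jact \<gamma> \<mu> \<nu> p) = (tauC p - wC p) / (autf \<gamma> (tauC p) * autf \<gamma> (wC p))"
  unfolding jact_def by (simp add: moeb_diff[OF \<gamma> autf_tau autf_w])

lemma tau_w: "tauC p - wC p \<noteq> 0"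
  using p by (simp add: cdomain_iff)

text \<open>The componentwise content of the transformation of the fields of \<open>R\<close> and \<open>L\<close>. The letters stand for
  \<open>j = c\<tau> + d\<close>, \<open>j' = cw + d\<close>, \<open>l = \<tau> - w\<close>, the translated coordinates \<open>x\<close>, \<open>y\<close>, the difference \<open>d\<close> of the
  original coordinates and the translation \<open>m\<close>.\<close>

lemma slope_identities:
  fixes x y d l m j j' c :: complex
  assumes "j \<noteq> 0" "j' \<noteq> 0" "l \<noteq> 0" "j - j' = c * l" "x - y = d + l * m"
  shows "1 / (l / (j * j')) * (1 / j * x - 1 / j' * y) = j * (1 / l * d + m) - c * x"
    and "l / (j * j') * (1 / j * x - 1 / j' * y) = 1 / j\<^sup>2 * (1 / j' * (l * d + l\<^sup>2 * m) - c * l\<^sup>2 / j'\<^sup>2 * y)"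
proof -
  have j': "j' = j - c * l" and y: "y = x - d - l * m"
    using assms(4,5) by (simp_all add: algebra_simps)
  have num: "j' * x - j * y = j * (d + l * m) - c * l * x"
    unfolding j' y by (simp add: algebra_simps)
  have quot: "1 / (l / (j * j')) * (1 / j * x - 1 / j' * y) = (j' * x - j * y) / l"
    using assms(1-3) by (simp add: field_simps)
  show "1 / (l / (j * j')) * (1 / j * x - 1 / j' * y) = j * (1 / l * d + m) - c * x"
    unfolding quot num using assms(3) by (simp add: field_simps)
  have j: "j = j' + c * l" and x: "x = y + d + l * m"
    using assms(4,5) by (simp_all add: algebra_simps)
  have num': "j' * x - j * y = j' * (d + l * m) - c * l * y"
    unfolding j x by (simp add: algebra_simps)
  have quot': "l / (j * j') * (1 / j * x - 1 / j' * y) = l * (j' * x - j * y) / (j\<^sup>2 * j'\<^sup>2)"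
    using assms(1-3) by (simp add: field_simps power2_eq_square)
  show "l / (j * j') * (1 / j * x - 1 / j' * y) = 1 / j\<^sup>2 * (1 / j' * (l * d + l\<^sup>2 * m) - c * l\<^sup>2 / j'\<^sup>2 * y)"
    unfolding quot' num' using assms(1,2) by (simp add: field_simps power2_eq_square)
qed

lemma shifted_diff: "shifted \<mu> \<nu> (zC p) (tauC p) - shifted \<mu> \<nu> (zetaC p) (wC p) = (zC p - zetaC p) + (tauC p - wC p) *s cvec \<mu>"
  by (simp add: shifted_def vec_eq_iff algebra_simps)

text \<open>The new slope \<open>(z - \<zeta>) / (\<tau> - w)\<close> is affine in the old one, with coefficients that depend on \<open>z\<close> and \<open>\<tau>\<close> only.
  This single identity governs the transformation of \<open>fieldR\<close>, \<open>potR\<close> and \<open>potD\<close>.\<close>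

lemma jact_slope:
  "(1 / (tauC (jact \<gamma> \<mu> \<nu> p) - wC (jact \<gamma> \<mu> \<nu> p))) *s (zC (jact \<gamma> \<mu> \<nu> p) - zetaC (jact \<gamma> \<mu> \<nu> p))
    = autf \<gamma> (tauC p) *s ((1 / (tauC p - wC p)) *s (zC p - zetaC p) + cvec \<mu>)
      - of_int (\<gamma> $ 2 $ 1) *s shifted \<mu> \<nu> (zC p) (tauC p)" (is "?L = ?R")
proof (rule vec_eq_iff[THEN iffD2], rule allI)
  fix i
  have "shifted \<mu> \<nu> (zC p) (tauC p) $ i - shifted \<mu> \<nu> (zetaC p) (wC p) $ i = (zC p - zetaC p) $ i + (tauC p - wC p) * cvec \<mu> $ i"
    using arg_cong[OF shifted_diff, of "\<lambda>v. v $ i"]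
    by (simp only: vector_add_component vector_minus_component vector_smult_component)
  from slope_identities(1)[OF autf_tau autf_w tau_w autf_diff this]
  show "?L $ i = ?R $ i"
    unfolding jact_diff
    by (simp only: jact_def fst_conv snd_conv vector_add_component vector_minus_component vector_smult_component)
qed

lemma jact_fieldL:
  "(tauC (jact \<gamma> \<mu> \<nu> p) - wC (jact \<gamma> \<mu> \<nu> p)) *s (zC (jact \<gamma> \<mu> \<nu> p) - zetaC (jact \<gamma> \<mu> \<nu> p))
    = (1 / (autf \<gamma> (tauC p))\<^sup>2) *s ((1 / autf \<gamma> (wC p)) *s ((tauC p - wC p) *s (zC p - zetaC p) + (tauC p - wC p)\<^sup>2 *s cvec \<mu>)
      - (of_int (\<gamma> $ 2 $ 1) * (tauC p - wC p)\<^sup>2 / (autf \<gamma> (wC p))\<^sup>2) *s shifted \<mu> \<nu> (zetaC p) (wC p))" (is "?L = ?R")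
proof (rule vec_eq_iff[THEN iffD2], rule allI)
  fix i
  have "shifted \<mu> \<nu> (zC p) (tauC p) $ i - shifted \<mu> \<nu> (zetaC p) (wC p) $ i = (zC p - zetaC p) $ i + (tauC p - wC p) * cvec \<mu> $ i"
    using arg_cong[OF shifted_diff, of "\<lambda>v. v $ i"]
    by (simp only: vector_add_component vector_minus_component vector_smult_component)
  from slope_identities(2)[OF autf_tau autf_w tau_w autf_diff this]
  show "?L $ i = ?R $ i"
    unfolding jact_diff
    by (simp only: jact_def fst_conv snd_conv vector_add_component vector_minus_component vector_smult_component)
qed

text \<open>The action sends each of the four fields to itself up to a power of \<open>c\<tau> + d\<close>.\<close>

lemma push_D: "jact' \<gamma> \<mu> \<nu> p (fieldD \<alpha> p) = cscale (1 / autf \<gamma> (tauC p)) (fieldD \<alpha> (jact \<gamma> \<mu> \<nu> p))"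
  by (simp add: jact'_def fieldD_def cscale_def)

lemma push_d: "jact' \<gamma> \<mu> \<nu> p (fieldd \<alpha> p) = cscale (autf \<gamma> (tauC p)) (fieldd \<alpha> (jact \<gamma> \<mu> \<nu> p))"
  unfolding fieldd_def jact_diff using autf_tau by (simp add: jact'_def cscale_def vec_eq_iff algebra_simps diff_divide_distrib)

lemma push_R: "jact' \<gamma> \<mu> \<nu> p (fieldR p) = cscale (1 / (autf \<gamma> (tauC p))\<^sup>2) (fieldR (jact \<gamma> \<mu> \<nu> p))"
proof -
  define y where "y = (1 / (tauC p - wC p)) *s (zC p - zetaC p)"
  show ?thesis
    unfolding fieldR_def jact_slope y_def[symmetric] using autf_tau
    by (simp add: jact'_def cscale_def vec_eq_iff power2_eq_square field_simps)
qed

lemma push_L: "jact' \<gamma> \<mu> \<nu> p (fieldL p) = cscale ((autf \<gamma> (tauC p))\<^sup>2) (fieldL (jact \<gamma> \<mu> \<nu> p))"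
  unfolding fieldL_def jact_fieldL unfolding jact_diff using autf_tau
  by (simp add: jact'_def cscale_def power_divide power_mult_distrib)

lemma potD_alt: "potD A \<alpha> q = 2 * of_real pi * \<i> * bform A (axis \<alpha> 1) ((1 / (tauC q - wC q)) *s (zC q - zetaC q))"
  by (simp only: potD_def bform_scale_right) simp

text \<open>The matching conditions on the potentials: the exponential and the powers in \<open>jfactor\<close> are made so
  that their logarithmic derivatives compensate the failure of the potentials to be equivariant.\<close>

lemma weight_D:
  "jfactor_logder A r \<kappa> \<gamma> \<mu> \<nu> p (fieldD \<alpha> p) + potD A \<alpha> p = 1 / autf \<gamma> (tauC p) * potD A \<alpha> (jact \<gamma> \<mu> \<nu> p)"
  unfolding potD_alt jact_slope using autf_tau
  by (simp add: jfactor_logder_def jexponent'_def fieldD_def bform_simps bform_commute[OF A, of "axis \<alpha> 1"] field_simps)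

lemma weight_d: "jfactor_logder A r \<kappa> \<gamma> \<mu> \<nu> p (fieldd \<alpha> p) + 0 = autf \<gamma> (tauC p) * 0"
  by (simp add: jfactor_logder_def jexponent'_def fieldd_def bform_simps)

text \<open>Both sides are \<open>r / 2 * l * j / j'\<close> with \<open>j = c\<tau> + d\<close>, \<open>j' = cw + d\<close>, \<open>l = \<tau> - w\<close>: the square roots in \<open>jfactor\<close>
  supply the difference.\<close>

lemma weight_L:
  "jfactor_logder A r \<kappa> \<gamma> \<mu> \<nu> p (fieldL p) + potL (of_nat r / 2) p = (autf \<gamma> (tauC p))\<^sup>2 * potL (of_nat r / 2) (jact \<gamma> \<mu> \<nu> p)"
proof -
  define j j' l c where "j = autf \<gamma> (tauC p)" "j' = autf \<gamma> (wC p)" "l = tauC p - wC p" "c = (of_int (\<gamma> $ 2 $ 1) :: complex)"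
  have n: "j \<noteq> 0" "j' \<noteq> 0" using autf_tau autf_w by (simp_all add: j_j'_l_c_def)
  have e: "j = j' + c * l" using autf_diff[of \<gamma> "tauC p" "wC p"] by (simp add: j_j'_l_c_def algebra_simps)
  have "of_nat r / 2 * c * l\<^sup>2 / j' + of_nat r / 2 * l = of_nat r / 2 * l * (j' + c * l) / j'"
    using n by (simp add: field_simps power2_eq_square)
  also have "\<dots> = j\<^sup>2 * (of_nat r / 2 * (l / (j * j')))"
    using n unfolding e[symmetric] by (simp add: field_simps power2_eq_square)
  finally show ?thesis
    unfolding potL_def jact_diff by (simp add: jfactor_logder_def jexponent'_def fieldL_def bform_zero_right flip: j_j'_l_c_def)
qed

text \<open>The part linear in \<open>\<kappa>\<close> is the transformation of \<open>1 / (\<tau> - w)\<close>. The quadratic part is the expansion of \<open>Q\<close> at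
  the transformed slope: the exponent of the slash operation is a completion of the square.\<close>

lemma weight_R:
  "jfactor_logder A r \<kappa> \<gamma> \<mu> \<nu> p (fieldR p) + potR A (\<kappa> - of_nat r / 2) p
    = 1 / (autf \<gamma> (tauC p))\<^sup>2 * potR A (\<kappa> - of_nat r / 2) (jact \<gamma> \<mu> \<nu> p)"
proof -
  define j j' l c where "j = autf \<gamma> (tauC p)" "j' = autf \<gamma> (wC p)" "l = tauC p - wC p" "c = (of_int (\<gamma> $ 2 $ 1) :: complex)"
  define Z m y where "Z = shifted \<mu> \<nu> (zC p) (tauC p)" "m = (cvec \<mu> :: complex ^ 'n)" "y = (1 / (tauC p - wC p)) *s (zC p - zetaC p)"
  define \<kappa>' where "\<kappa>' = \<kappa> - of_nat r / 2"
  have n: "j \<noteq> 0" "j' \<noteq> 0" "l \<noteq> 0" using autf_tau autf_w tau_w by (simp_all add: j_j'_l_c_def)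
  have e: "j' = j - c * l" using autf_diff[of \<gamma> "tauC p" "wC p"] by (simp add: j_j'_l_c_def algebra_simps)
  have lin: "- \<kappa>' * c / j + \<kappa>' / l = 1 / j\<^sup>2 * (\<kappa>' / (l / (j * j')))"
    unfolding e using n by (simp add: field_simps power2_eq_square)
  \<comment> \<open>Completing the square: both sides are \<open>Q (y + m - (c / j) Z)\<close>, the left one expanded.\<close>
  have quad: "- c * (bform A Z (y + m) / j - qform A Z * c / j\<^sup>2) + qform A m + bform A m y + qform A y
      = 1 / j\<^sup>2 * qform A (j *s (y + m) - c *s Z)"
    unfolding qform_def using n
    by (simp add: bform_simps bform_commute[OF A, of m y] bform_commute[OF A, of m Z] bform_commute[OF A, of y Z] field_simps power2_eq_square)
  have "jfactor_logder A r \<kappa> \<gamma> \<mu> \<nu> p (fieldR p) = - \<kappa>' * c / j + 2 * of_real pi * \<i> * (- c * (bform A Z (y + m) / j - qform A Z * c / j\<^sup>2) + qform A m + bform A m y)"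
    by (simp add: jfactor_logder_def jexponent'_def fieldR_def Z_m_y_def j_j'_l_c_def \<kappa>'_def)
  moreover have "potR A \<kappa>' p = 2 * of_real pi * \<i> * qform A y + \<kappa>' / l"
    by (simp add: potR_def Z_m_y_def j_j'_l_c_def)
  moreover have "potR A \<kappa>' (jact \<gamma> \<mu> \<nu> p) = 2 * of_real pi * \<i> * qform A (j *s (y + m) - c *s Z) + \<kappa>' / (l / (j * j'))"
    unfolding potR_def jact_slope unfolding jact_diff by (simp only: Z_m_y_def j_j'_l_c_def)
  ultimately have "jfactor_logder A r \<kappa> \<gamma> \<mu> \<nu> p (fieldR p) + potR A \<kappa>' p
      = (- \<kappa>' * c / j + \<kappa>' / l) + 2 * of_real pi * \<i> * (- c * (bform A Z (y + m) / j - qform A Z * c / j\<^sup>2) + qform A m + bform A m y + qform A y)"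
    by (simp only: ring_distribs add_ac)
  also have "\<dots> = 1 / j\<^sup>2 * potR A \<kappa>' (jact \<gamma> \<mu> \<nu> p)"
    unfolding lin quad \<open>potR A \<kappa>' (jact \<gamma> \<mu> \<nu> p) = _\<close> by (simp only: ring_distribs mult_ac add_ac)
  finally show ?thesis
    by (simp only: \<kappa>'_def j_j'_l_c_def)
qed

lemma jfactor_weights:
  "jfactor A r (\<kappa> + 1) \<gamma> \<mu> \<nu> p = 1 / autf \<gamma> (tauC p) * jfactor A r \<kappa> \<gamma> \<mu> \<nu> p"
  "jfactor A r (\<kappa> - 1) \<gamma> \<mu> \<nu> p = autf \<gamma> (tauC p) * jfactor A r \<kappa> \<gamma> \<mu> \<nu> p"
  "jfactor A r (\<kappa> + 2) \<gamma> \<mu> \<nu> p = 1 / (autf \<gamma> (tauC p))\<^sup>2 * jfactor A r \<kappa> \<gamma> \<mu> \<nu> p"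
  "jfactor A r (\<kappa> - 2) \<gamma> \<mu> \<nu> p = (autf \<gamma> (tauC p))\<^sup>2 * jfactor A r \<kappa> \<gamma> \<mu> \<nu> p"
proof -
  define j where "j = autf \<gamma> (tauC p)"
  have j: "j \<noteq> 0" using autf_tau by (simp add: j_def)
  have "j powr 2 = j\<^sup>2"
    using powr_add[of j 1 1] j by (simp add: power2_eq_square)
  moreover have "j powr (- (\<kappa> + m)) = 1 / j powr m * j powr (- \<kappa>)" for m
    using powr_diff[of j "- \<kappa>" m] by simp
  moreover have "j powr (- (\<kappa> - m)) = j powr m * j powr (- \<kappa>)" for m
    using powr_add[of j m "- \<kappa>"] by simp
  ultimately have "j powr (- (\<kappa> + 1)) = 1 / j * j powr (- \<kappa>)" "j powr (- (\<kappa> - 1)) = j * j powr (- \<kappa>)"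
    "j powr (- (\<kappa> + 2)) = 1 / j\<^sup>2 * j powr (- \<kappa>)" "j powr (- (\<kappa> - 2)) = j\<^sup>2 * j powr (- \<kappa>)"
    using j by (simp_all only: powr_to_1)
  then show
    "jfactor A r (\<kappa> + 1) \<gamma> \<mu> \<nu> p = 1 / autf \<gamma> (tauC p) * jfactor A r \<kappa> \<gamma> \<mu> \<nu> p"
    "jfactor A r (\<kappa> - 1) \<gamma> \<mu> \<nu> p = autf \<gamma> (tauC p) * jfactor A r \<kappa> \<gamma> \<mu> \<nu> p"
    "jfactor A r (\<kappa> + 2) \<gamma> \<mu> \<nu> p = 1 / (autf \<gamma> (tauC p))\<^sup>2 * jfactor A r \<kappa> \<gamma> \<mu> \<nu> p"
    "jfactor A r (\<kappa> - 2) \<gamma> \<mu> \<nu> p = (autf \<gamma> (tauC p))\<^sup>2 * jfactor A r \<kappa> \<gamma> \<mu> \<nu> p"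
    unfolding jfactor_def j_def[symmetric] by (simp_all only: mult.assoc)
qed

end

section \<open>Covariance and commutation on functions of the Jacobi type\<close>

lemma jact'_cscale: "jact' \<gamma> \<mu> \<nu> p (cscale c u) = cscale c (jact' \<gamma> \<mu> \<nu> p u)"
  by (simp add: jact'_def cscale_def split_beta vec_eq_iff algebra_simps)

lemma jfactor_logder_cscale: "jfactor_logder A r \<kappa> \<gamma> \<mu> \<nu> p (cscale c u) = c * jfactor_logder A r \<kappa> \<gamma> \<mu> \<nu> p u"
  by (simp add: jfactor_logder_def jexponent'_def cscale_def split_beta bform_simps algebra_simps diff_divide_distrib)

lemma holo_pullback:
  assumes A: "transpose A = A" and \<gamma>: "\<gamma> \<in> SL2Z" and f: "jac.holo cdomain f"
  shows "jac.holo cdomain (\<lambda>p. jfactor A r \<kappa> \<gamma> \<mu> \<nu> p * f (jact \<gamma> \<mu> \<nu> p))"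
proof (rule jac.holo_mult)
  show "jac.holo cdomain (jfactor A r \<kappa> \<gamma> \<mu> \<nu>)"
    by (rule jac.holoI, erule jfactor_deriv[OF A \<gamma>]) (simp add: jfactor_logder_cscale)
  show "jac.holo cdomain (\<lambda>p. f (jact \<gamma> \<mu> \<nu> p))"
  proof (rule jac.holoI)
    fix p :: "'a point" assume p: "p \<in> cdomain"
    show "((\<lambda>p. f (jact \<gamma> \<mu> \<nu> p)) has_derivative (\<lambda>u. Df f (jact \<gamma> \<mu> \<nu> p) (jact' \<gamma> \<mu> \<nu> p u))) (at p)"
      by (rule has_derivative_compose[where g = f, OF jact_deriv[OF A \<gamma> p]])
        (rule jac.holo_has_derivative[OF f jact_cdomain[OF A \<gamma> p]])
    show "Df f (jact \<gamma> \<mu> \<nu> p) (jact' \<gamma> \<mu> \<nu> p (cscale c u)) = c * Df f (jact \<gamma> \<mu> \<nu> p) (jact' \<gamma> \<mu> \<nu> p u)" for c u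
      by (simp add: jact'_cscale jac.holo_sc[OF f jact_cdomain[OF A \<gamma> p]])
  qed
qed

text \<open>The discontinuous factors cancel: \<open>\<chi>\<close> compares the square root of \<open>\<i>(w - \<tau>)\<close> with the one at the
  image point, up to the holomorphic roots of \<open>c\<tau> + d\<close> and \<open>cw + d\<close>.\<close>

lemma chi_inv_root:
  assumes r: "r \<in> {0, 1}" and \<gamma>: "\<gamma> \<in> SL2Z" and h: "(\<tau>, w) \<in> half_pairs"
  shows "chi \<tau> w \<gamma> ^ r * inv_root r (moeb \<gamma> \<tau>) (moeb \<gamma> w) = csqrt (autf \<gamma> \<tau>) ^ r * csqrt (autf \<gamma> w) ^ r * inv_root r \<tau> w"
proof -
  have n: "autf \<gamma> \<tau> \<noteq> 0" "autf \<gamma> w \<noteq> 0" "w \<noteq> \<tau>" and m: "moeb \<gamma> w \<noteq> moeb \<gamma> \<tau>"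
    using h autf_nonzero[OF \<gamma>] moeb_half_pairs[OF \<gamma> h] by (auto simp: half_pairs_def)
  show ?thesis
  proof (cases "r = 0")
    case True
    then show ?thesis using n m by (simp add: inv_root_def)
  next
    case False
    with r have r: "r = 1" by simp
    have inv_root: "inv_root 1 a b = 1 / csqrt (\<i> * (b - a))" if "b \<noteq> a" for a b
      using that by (simp add: inv_root_def csqrt_conv_powr)
    have "\<i> * (moeb \<gamma> w - moeb \<gamma> \<tau>) = \<i> * (w - \<tau>) / (autf \<gamma> \<tau> * autf \<gamma> w)"
      using moeb_diff[OF \<gamma> n(2,1)] by (simp add: mult.commute)
    moreover have "csqrt (\<i> * (w - \<tau>) / (autf \<gamma> \<tau> * autf \<gamma> w)) \<noteq> 0"
      using n by (simp del: csqrt.simps)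
    ultimately show ?thesis
      unfolding r inv_root[OF m] inv_root[OF n(3)] chi_def by (simp del: csqrt.simps)
  qed
qed

lemma chi_values:
  assumes \<gamma>: "\<gamma> \<in> SL2Z" and h: "(\<tau>, w) \<in> half_pairs"
  shows "chi \<tau> w \<gamma> \<in> {1, -1}"
proof -
  have n: "autf \<gamma> \<tau> \<noteq> 0" "autf \<gamma> w \<noteq> 0" "w \<noteq> \<tau>"
    using h autf_nonzero[OF \<gamma>] by (auto simp: half_pairs_def)
  have "(chi \<tau> w \<gamma>)\<^sup>2 = 1"
    unfolding chi_def power_mult_distrib power_divide power2_csqrt using n by simp
  then show ?thesis by (simp add: power2_eq_1_iff)
qed

lemma is_lift_slash:
  fixes g :: "('n::finite, 'm::finite) jfun"
  assumes r: "r \<in> {0, 1}" and \<gamma>: "\<gamma> \<in> SL2Z" and g: "\<And>j. is_lift r g j (f j)"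
  shows "is_lift r (slash A r \<rho> k g (\<gamma>, \<mu>, \<nu>)) i
    (\<lambda>p. jfactor A r (of_real k) \<gamma> \<mu> \<nu> p * (\<Sum>j\<in>UNIV. matrix_inv (\<rho> \<gamma>) $ i $ j * f j (jact \<gamma> \<mu> \<nu> p)))"
  unfolding is_lift_def
proof (intro allI impI)
  fix z \<zeta> :: "complex ^ 'n" and \<tau> w assume h: "(\<tau>, w) \<in> half_pairs"
  let ?p = "(z, \<zeta>, \<tau>, w)"
  let ?S = "\<Sum>j\<in>UNIV. matrix_inv (\<rho> \<gamma>) $ i $ j * f j (jact \<gamma> \<mu> \<nu> ?p)"
  let ?e = "exp (2 * of_real pi * \<i> * jexponent A \<gamma> \<mu> \<nu> ?p)"
  have G: "g ((1 / autf \<gamma> \<tau>) *s (z + \<tau> *s cvec \<mu> + cvec \<nu>)) ((1 / autf \<gamma> w) *s (\<zeta> + w *s cvec \<mu> + cvec \<nu>)) (moeb \<gamma> \<tau>) (moeb \<gamma> w) $ j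
      = inv_root r (moeb \<gamma> \<tau>) (moeb \<gamma> w) * f j (jact \<gamma> \<mu> \<nu> ?p)" for j
    unfolding is_liftD[OF g moeb_half_pairs[OF \<gamma> h]] jact_def shifted_def by simp
  have "slash A r \<rho> k g (\<gamma>, \<mu>, \<nu>) z \<zeta> \<tau> w $ i
      = (chi \<tau> w \<gamma> ^ r * autf \<gamma> \<tau> powr (- of_real k) * ?e)
        * (\<Sum>j\<in>UNIV. matrix_inv (\<rho> \<gamma>) $ i $ j * (inv_root r (moeb \<gamma> \<tau>) (moeb \<gamma> w) * f j (jact \<gamma> \<mu> \<nu> ?p)))"
    unfolding slash_def case_prod_conv vector_smult_component matrix_vector_mult_def vec_lambda_beta G
    by (simp only: jexponent_def shifted_def fst_conv snd_conv)
  also have "(\<Sum>j\<in>UNIV. matrix_inv (\<rho> \<gamma>) $ i $ j * (inv_root r (moeb \<gamma> \<tau>) (moeb \<gamma> w) * f j (jact \<gamma> \<mu> \<nu> ?p)))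
      = inv_root r (moeb \<gamma> \<tau>) (moeb \<gamma> w) * ?S"
    by (simp only: sum_distrib_left mult.left_commute)
  also have "(chi \<tau> w \<gamma> ^ r * autf \<gamma> \<tau> powr (- of_real k) * ?e) * (inv_root r (moeb \<gamma> \<tau>) (moeb \<gamma> w) * ?S)
      = (chi \<tau> w \<gamma> ^ r * inv_root r (moeb \<gamma> \<tau>) (moeb \<gamma> w)) * (autf \<gamma> \<tau> powr (- of_real k) * ?e * ?S)"
    by (simp only: mult_ac)
  also have "\<dots> = inv_root r \<tau> w * (jfactor A r (of_real k) \<gamma> \<mu> \<nu> ?p * ?S)"
    unfolding chi_inv_root[OF r \<gamma> h] jfactor_def fst_conv snd_conv by (simp only: mult_ac)
  finally show "slash A r \<rho> k g (\<gamma>, \<mu>, \<nu>) z \<zeta> \<tau> w $ i = inv_root r \<tau> w * (jfactor A r (of_real k) \<gamma> \<mu> \<nu> ?p * ?S)" .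
qed

text \<open>The general covariance statement: an operator that acts on holomorphic parts through \<open>(v, b)\<close> commutes
  with the slash operation, up to the change of weight that turns the factor for \<open>k\<close> into \<open>c\<close> times itself. The matrix \<open>\<rho> \<gamma>\<close> is constant,
  so it passes through by linearity.\<close>

lemma slash_covariance:
  fixes g :: "('n::finite, 'm::finite) jfun" and X :: "('n, 'm) jfun \<Rightarrow> ('n, 'm) jfun"
  assumes A: "transpose A = A" and r: "r \<in> {0, 1}" and \<gamma>: "\<gamma> \<in> SL2Z"
    and f: "\<And>j. jac.holo cdomain (f j)" and g: "\<And>j. is_lift r g j (f j)"
    and X: "\<And>g f j. is_lift r g j f \<Longrightarrow> jac.holo cdomain f \<Longrightarrow> is_lift r (X g) j (jac.first_order v b f)"
    and h: "(\<tau>, w) \<in> half_pairs"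
    and push: "jact' \<gamma> \<mu> \<nu> (z, \<zeta>, \<tau>, w) (v (z, \<zeta>, \<tau>, w)) = cscale c (v (jact \<gamma> \<mu> \<nu> (z, \<zeta>, \<tau>, w)))"
    and weight: "jfactor_logder A r (of_real k) \<gamma> \<mu> \<nu> (z, \<zeta>, \<tau>, w) (v (z, \<zeta>, \<tau>, w)) + b (z, \<zeta>, \<tau>, w)
      = c * b (jact \<gamma> \<mu> \<nu> (z, \<zeta>, \<tau>, w))"
    and k': "jfactor A r (of_real k') \<gamma> \<mu> \<nu> (z, \<zeta>, \<tau>, w) = c * jfactor A r (of_real k) \<gamma> \<mu> \<nu> (z, \<zeta>, \<tau>, w)"
  shows "X (slash A r \<rho> k g (\<gamma>, \<mu>, \<nu>)) z \<zeta> \<tau> w = slash A r \<rho> k' (X g) (\<gamma>, \<mu>, \<nu>) z \<zeta> \<tau> w"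
proof (rule vec_eq_iff[THEN iffD2], rule allI)
  fix i
  let ?p = "(z, \<zeta>, \<tau>, w)"
  let ?J = "jfactor A r (of_real k) \<gamma> \<mu> \<nu>"
  let ?F = "\<lambda>q. \<Sum>j\<in>UNIV. matrix_inv (\<rho> \<gamma>) $ i $ j * f j q"
  have p: "?p \<in> cdomain" using h by (simp add: cdomain_def)
  have F: "jac.holo cdomain ?F" by (intro jac.holo_sum jac.holo_cmult f)
  have w: "?J ?p * jfactor_logder A r (of_real k) \<gamma> \<mu> \<nu> ?p (v ?p) + b ?p * ?J ?p = c * ?J ?p * b (jact \<gamma> \<mu> \<nu> ?p)"
    using arg_cong[OF weight, of "\<lambda>x. x * ?J ?p"] by (simp only: ring_distribs mult_ac)
  have "X (slash A r \<rho> k g (\<gamma>, \<mu>, \<nu>)) z \<zeta> \<tau> w $ i = inv_root r \<tau> w * jac.first_order v b (\<lambda>q. ?J q * ?F (jact \<gamma> \<mu> \<nu> q)) ?p"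
    by (rule is_liftD[OF X h], rule is_lift_slash[OF r \<gamma> g], rule holo_pullback[OF A \<gamma> F])
  also have "jac.first_order v b (\<lambda>q. ?J q * ?F (jact \<gamma> \<mu> \<nu> q)) ?p = c * ?J ?p * jac.first_order v b ?F (jact \<gamma> \<mu> \<nu> ?p)"
    by (rule jac.first_order_pullback[where f = ?F, OF F jact_cdomain[OF A \<gamma> p] jact_deriv[OF A \<gamma> p] jfactor_deriv[OF A \<gamma> p] push w])
  also have "jac.first_order v b ?F (jact \<gamma> \<mu> \<nu> ?p) = (\<Sum>j\<in>UNIV. matrix_inv (\<rho> \<gamma>) $ i $ j * jac.first_order v b (f j) (jact \<gamma> \<mu> \<nu> ?p))"
    by (rule jac.first_order_sum[OF f jact_cdomain[OF A \<gamma> p]])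
  also have "inv_root r \<tau> w * (c * ?J ?p * \<dots>) = slash A r \<rho> k' (X g) (\<gamma>, \<mu>, \<nu>) z \<zeta> \<tau> w $ i"
    unfolding k'[symmetric] by (rule is_liftD[OF is_lift_slash[OF r \<gamma> X[OF g f]] h, symmetric])
  finally show "X (slash A r \<rho> k g (\<gamma>, \<mu>, \<nu>)) z \<zeta> \<tau> w $ i = slash A r \<rho> k' (X g) (\<gamma>, \<mu>, \<nu>) z \<zeta> \<tau> w $ i" .
qed

lemma lifted_commutator:
  fixes F G H :: "('n::finite, 'm::finite) jfun"
  assumes "\<And>j. is_lift r F j (a j)" "\<And>j. is_lift r G j (b j)" "\<And>j. is_lift r H j (c j)"
    and "\<And>j p. p \<in> cdomain \<Longrightarrow> a j p - b j p = s * c j p" and "(\<tau>, w) \<in> half_pairs"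
  shows "F z \<zeta> \<tau> w - G z \<zeta> \<tau> w = s *s H z \<zeta> \<tau> w"
proof (rule vec_eq_iff[THEN iffD2], rule allI)
  fix j
  have "inv_root r \<tau> w * (a j (z, \<zeta>, \<tau>, w) - b j (z, \<zeta>, \<tau>, w)) = inv_root r \<tau> w * (s * c j (z, \<zeta>, \<tau>, w))"
    using assms(4)[of "(z, \<zeta>, \<tau>, w)" j] assms(5) by (simp add: cdomain_def)
  then show "(F z \<zeta> \<tau> w - G z \<zeta> \<tau> w) $ j = (s *s H z \<zeta> \<tau> w) $ j"
    unfolding vector_minus_component vector_smult_component is_liftD[OF assms(1) assms(5)] is_liftD[OF assms(2) assms(5)]
      is_liftD[OF assms(3) assms(5)] by (simp only: right_diff_distrib mult.left_commute)
qed

theorem proposition3p3: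
  fixes A :: "int ^ ('n::finite) ^ 'n" and k :: real and r :: nat and g :: "('n, 'm::finite) jfun"
  assumes "symmetric_pos_def A"
    and "2 * k \<in> \<int>"
    and "r \<in> {0, 1}"
    and "admissible r g"
  shows
    "(\<forall>\<gamma>\<in>SL2Z. \<forall>(\<tau>, w)\<in>half_pairs. chi \<tau> w \<gamma> \<in> {1, -1})
     \<and>
     (\<forall>\<rho>. (\<forall>\<gamma>\<in>SL2Z. unitary_matrix (\<rho> \<gamma>)) \<and> projective_rep \<rho> \<and> slash_well_defined A r \<rho> k \<longrightarrow>
       (\<forall>\<xi>\<in>jacobi_group. \<forall>\<alpha> z \<zeta> \<tau> w. (\<tau>, w) \<in> half_pairs \<longrightarrow>
          opD A \<alpha> (slash A r \<rho> k g \<xi>) z \<zeta> \<tau> w = slash A r \<rho> (k + 1) (opD A \<alpha> g) \<xi> z \<zeta> \<tau> w \<and>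
          opd \<alpha> (slash A r \<rho> k g \<xi>) z \<zeta> \<tau> w = slash A r \<rho> (k - 1) (opd \<alpha> g) \<xi> z \<zeta> \<tau> w \<and>
          opR A k (slash A r \<rho> k g \<xi>) z \<zeta> \<tau> w = slash A r \<rho> (k + 2) (opR A k g) \<xi> z \<zeta> \<tau> w \<and>
          opL (slash A r \<rho> k g \<xi>) z \<zeta> \<tau> w = slash A r \<rho> (k - 2) (opL g) \<xi> z \<zeta> \<tau> w))
     \<and>
     (\<forall>\<alpha> \<beta> z \<zeta> \<tau> w. (\<tau>, w) \<in> half_pairs \<longrightarrow>
        opD A \<alpha> (opD A \<beta> g) z \<zeta> \<tau> w - opD A \<beta> (opD A \<alpha> g) z \<zeta> \<tau> w = 0 \<and>
        opd \<alpha> (opd \<beta> g) z \<zeta> \<tau> w - opd \<beta> (opd \<alpha> g) z \<zeta> \<tau> w = 0 \<and>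
        opD A \<alpha> (opd \<beta> g) z \<zeta> \<tau> w - opd \<beta> (opD A \<alpha> g) z \<zeta> \<tau> w
          = (2 * of_real pi * \<i> * of_int (A $ \<alpha> $ \<beta>)) *s g z \<zeta> \<tau> w \<and>
        opL (opR A k g) z \<zeta> \<tau> w - opR A (k - 2) (opL g) z \<zeta> \<tau> w = of_real k *s g z \<zeta> \<tau> w \<and>
        opd \<alpha> (opR A k g) z \<zeta> \<tau> w - opR A (k - 1) (opd \<alpha> g) z \<zeta> \<tau> w = - opD A \<alpha> g z \<zeta> \<tau> w \<and>
        opd \<alpha> (opL g) z \<zeta> \<tau> w - opL (opd \<alpha> g) z \<zeta> \<tau> w = 0 \<and>
        opD A \<alpha> (opR A k g) z \<zeta> \<tau> w - opR A (k + 1) (opD A \<alpha> g) z \<zeta> \<tau> w = 0 \<and>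
        opD A \<alpha> (opL g) z \<zeta> \<tau> w - opL (opD A \<alpha> g) z \<zeta> \<tau> w = opd \<alpha> g z \<zeta> \<tau> w)"
proof (intro conjI allI ballI impI)
  have A: "transpose A = A" using assms(1) by (simp add: symmetric_pos_def_def)
  obtain f where f: "\<And>j. jac.holo cdomain (f j)" and g: "\<And>j. is_lift r g j (f j)"
    by (rule admissible_is_lift[OF assms(4)]) (rule that; assumption)
  note holo = jac.holo_first_order[OF f open_cdomain]
  note after_D = is_lift_D[OF g f] holo[OF holo_fields(3) holo_potD]
    and after_d = is_lift_d[OF g f] holo[OF holo_fields(4) jac.holo_const]
    and after_R = is_lift_R[OF g f] holo[OF holo_fields(1) holo_potR[OF A]]
    and after_L = is_lift_L[OF g f] holo[OF holo_fields(2) holo_potL]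
  show "case x of (\<tau>, w) \<Rightarrow> chi \<tau> w \<gamma> \<in> {1, -1}" if "\<gamma> \<in> SL2Z" "x \<in> half_pairs" for \<gamma> x
    using that chi_values by auto
  {
    fix \<rho> :: "int ^ 2 ^ 2 \<Rightarrow> complex ^ 'm ^ 'm" and \<xi> :: "'n jacobi" and \<alpha> and z \<zeta> :: "complex ^ 'n" and \<tau> w
    assume "\<xi> \<in> jacobi_group" and h: "(\<tau>, w) \<in> half_pairs"
    then obtain \<gamma> \<mu> \<nu> where \<xi>: "\<xi> = (\<gamma>, \<mu>, \<nu>)" and \<gamma>: "\<gamma> \<in> SL2Z"
      by (auto simp: jacobi_group_def)
    have p: "(z, \<zeta>, \<tau>, w) \<in> cdomain" using h by (simp add: cdomain_def)
    note cov = slash_covariance[OF A assms(3) \<gamma> f g _ h]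
    show "opD A \<alpha> (slash A r \<rho> k g \<xi>) z \<zeta> \<tau> w = slash A r \<rho> (k + 1) (opD A \<alpha> g) \<xi> z \<zeta> \<tau> w"
      unfolding \<xi> by (rule cov, erule (1) is_lift_D, rule push_D[OF A \<gamma> p], rule weight_D[OF A \<gamma> p])
        (simp only: of_real_add of_real_1 jfactor_weights[OF A \<gamma> p])
    show "opd \<alpha> (slash A r \<rho> k g \<xi>) z \<zeta> \<tau> w = slash A r \<rho> (k - 1) (opd \<alpha> g) \<xi> z \<zeta> \<tau> w"
      unfolding \<xi> by (rule cov, erule (1) is_lift_d, rule push_d[OF A \<gamma> p], rule weight_d[OF A \<gamma> p])
        (simp only: of_real_diff of_real_1 jfactor_weights[OF A \<gamma> p])
    show "opR A k (slash A r \<rho> k g \<xi>) z \<zeta> \<tau> w = slash A r \<rho> (k + 2) (opR A k g) \<xi> z \<zeta> \<tau> w"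
      unfolding \<xi> by (rule cov, erule (1) is_lift_R, rule push_R[OF A \<gamma> p], rule weight_R[OF A \<gamma> p])
        (simp only: of_real_add of_real_numeral jfactor_weights[OF A \<gamma> p])
    show "opL (slash A r \<rho> k g \<xi>) z \<zeta> \<tau> w = slash A r \<rho> (k - 2) (opL g) \<xi> z \<zeta> \<tau> w"
      unfolding \<xi> by (rule cov, erule (1) is_lift_L, rule push_L[OF A \<gamma> p], rule weight_L[OF A \<gamma> p])
        (simp only: of_real_diff of_real_numeral jfactor_weights[OF A \<gamma> p])
  }
  {
    fix \<alpha> \<beta> and z \<zeta> :: "complex ^ 'n" and \<tau> w assume h: "(\<tau>, w) \<in> half_pairs"
    \<comment> \<open>On holomorphic parts the weights are shifted by \<open>r / 2\<close>. Each right-hand side is written as a scalar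
      times a function with a known holomorphic part, as \<open>lifted_commutator\<close> expects.\<close>
    let ?\<kappa> = "of_real k - of_nat r / 2 :: complex"
    have \<kappa>: "of_real (k - 2) - of_nat r / 2 = ?\<kappa> - 2" "of_real (k - 1) - of_nat r / 2 = ?\<kappa> - 1"
      "of_real (k + 1) - of_nat r / 2 = ?\<kappa> + 1"
      by simp_all
    have "opD A \<alpha> (opD A \<beta> g) z \<zeta> \<tau> w - opD A \<beta> (opD A \<alpha> g) z \<zeta> \<tau> w = 0 *s g z \<zeta> \<tau> w"
      by (rule lifted_commutator[OF is_lift_D[OF after_D] is_lift_D[OF after_D] g _ h])
        (simp only: commutator_DD[OF A f] mult_zero_left)
    then show "opD A \<alpha> (opD A \<beta> g) z \<zeta> \<tau> w - opD A \<beta> (opD A \<alpha> g) z \<zeta> \<tau> w = 0"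
      by simp
    have "opd \<alpha> (opd \<beta> g) z \<zeta> \<tau> w - opd \<beta> (opd \<alpha> g) z \<zeta> \<tau> w = 0 *s g z \<zeta> \<tau> w"
      by (rule lifted_commutator[OF is_lift_d[OF after_d] is_lift_d[OF after_d] g _ h])
        (simp only: commutator_dd[OF A f] mult_zero_left)
    then show "opd \<alpha> (opd \<beta> g) z \<zeta> \<tau> w - opd \<beta> (opd \<alpha> g) z \<zeta> \<tau> w = 0"
      by simp
    show "opD A \<alpha> (opd \<beta> g) z \<zeta> \<tau> w - opd \<beta> (opD A \<alpha> g) z \<zeta> \<tau> w
          = (2 * of_real pi * \<i> * of_int (A $ \<alpha> $ \<beta>)) *s g z \<zeta> \<tau> w"
      by (rule lifted_commutator[OF is_lift_D[OF after_d] is_lift_d[OF after_D] g _ h])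
        (simp only: commutator_Dd[OF A f])
    show "opL (opR A k g) z \<zeta> \<tau> w - opR A (k - 2) (opL g) z \<zeta> \<tau> w = of_real k *s g z \<zeta> \<tau> w"
      by (rule lifted_commutator[OF is_lift_L[OF after_R] is_lift_R[OF after_L] g _ h])
        (simp only: \<kappa> commutator_LR[OF A f] diff_add_cancel)
    have "opd \<alpha> (opR A k g) z \<zeta> \<tau> w - opR A (k - 1) (opd \<alpha> g) z \<zeta> \<tau> w = (- 1) *s opD A \<alpha> g z \<zeta> \<tau> w"
      by (rule lifted_commutator[OF is_lift_d[OF after_R] is_lift_R[OF after_d] is_lift_D[OF g f] _ h])
        (simp only: \<kappa> commutator_dR[OF A f] mult_minus1)
    then show "opd \<alpha> (opR A k g) z \<zeta> \<tau> w - opR A (k - 1) (opd \<alpha> g) z \<zeta> \<tau> w = - opD A \<alpha> g z \<zeta> \<tau> w"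
      by (simp add: vec_eq_iff)
    have "opd \<alpha> (opL g) z \<zeta> \<tau> w - opL (opd \<alpha> g) z \<zeta> \<tau> w = 0 *s g z \<zeta> \<tau> w"
      by (rule lifted_commutator[OF is_lift_d[OF after_L] is_lift_L[OF after_d] g _ h])
        (simp only: commutator_dL[OF A f] mult_zero_left)
    then show "opd \<alpha> (opL g) z \<zeta> \<tau> w - opL (opd \<alpha> g) z \<zeta> \<tau> w = 0"
      by simp
    have "opD A \<alpha> (opR A k g) z \<zeta> \<tau> w - opR A (k + 1) (opD A \<alpha> g) z \<zeta> \<tau> w = 0 *s g z \<zeta> \<tau> w"
      by (rule lifted_commutator[OF is_lift_D[OF after_R] is_lift_R[OF after_D] g _ h])
        (simp only: \<kappa> commutator_DR[OF A f] mult_zero_left)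
    then show "opD A \<alpha> (opR A k g) z \<zeta> \<tau> w - opR A (k + 1) (opD A \<alpha> g) z \<zeta> \<tau> w = 0"
      by simp
    have "opD A \<alpha> (opL g) z \<zeta> \<tau> w - opL (opD A \<alpha> g) z \<zeta> \<tau> w = 1 *s opd \<alpha> g z \<zeta> \<tau> w"
      by (rule lifted_commutator[OF is_lift_D[OF after_L] is_lift_L[OF after_D] is_lift_d[OF g f] _ h])
        (simp only: commutator_DL[OF A f] mult_1_left)
    then show "opD A \<alpha> (opL g) z \<zeta> \<tau> w - opL (opD A \<alpha> g) z \<zeta> \<tau> w = opd \<alpha> g z \<zeta> \<tau> w"
      by simp
  }
qed

end
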